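(* Let $n\ge1$ and let $F:H^n_{\mathbb C}\to H^n_{\mathbb C}$ be a homeomorphism of the $n$-th complex Heisenberg group. If $F$ is both a quasiconformal map and a $C^2$ diffeomorphism, then after possibly composing with $\tau$ (i.e. replacing $F$ by $F\circ\tau$), $F$ is the lifting of a complex affine map $\mathbb C^{2n}\to\mathbb C^{2n}$. Furthermore, $F$ or $F\circ\tau$ is a complex affine map of $\mathbb C^{2n+1}$.
   Context: The $n$-th complex Heisenberg algebra $\mathcal H^n_{\mathbb C}$ is the complex Lie algebra with complex basis $X_i,Y_i$ ($1\le i\le n$), $Z$ and only nontrivial bracket relations $[X_i,Y_i]=Z$, $1\le i\le n$. It is graded with $V_1$ the complex span of the $X_i,Y_i$ and $V_2=\mathbb C Z$. $H^n_{\mathbb C}$ is the simply connected Lie group with Lie algebra $\mathcal H^n_{\mathbb C}$, equipped with a Carnot (sub-Riemannian) metric associated with $V_1$ (i.e. with the left invariant distribution determined by $V_1$ and a left invariant inner product on it). Both $H^n_{\mathbb C}$ and $\mathcal H^n_{\mathbb C}$ are identified with $\mathbb C^{2n+1}$ (via the exponential map and the complex basis consisting of $X_i,Y_i$ ($1\le i\le n$) and $Z$, with $Z$ corresponding to the last coordinate), so $V_1=\mathbb C^{2n}\times\{0\}$, $V_2=\{0\}\times\mathbb C$. Let $\pi_1:\mathbb C^{2n+1}\to\mathbb C^{2n}$ be the projection onto $V_1$. A map $F:\mathbb C^{2n+1}\to\mathbb C^{2n+1}$ is called a lifting of $f:\mathbb C^{2n}\to\mathbb C^{2n}$ if $F(\pi_1^{-1}(p))=\pi_1^{-1}(f(p))$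 for all $p\in\mathbb C^{2n}$. The map $\tau:H^n_{\mathbb C}\to H^n_{\mathbb C}$ is complex conjugation of all coordinates, $\tau(w_1,\dots,w_{2n},z)=(\overline{w_1},\dots,\overline{w_{2n}},\overline z)$. A homeomorphism $F$ of a metric space $(X,d)$ is quasiconformal if there is $H<\infty$ with $\limsup_{r\to0}\frac{\sup\{d(F(x),F(y)):d(x,y)\le r\}}{\inf\{d(F(x),F(y)):d(x,y)\ge r\}}\le H$ for all $x\in X$. (For Carnot groups this is equivalent to being quasisymmetric.) *)

theory Defs
  imports "HOL-Analysis.Analysis"
begin

text \<open>
  The points of \<open>\<complex>\<^sup>2\<^sup>n \<times> \<complex> = \<complex>\<^sup>2\<^sup>n\<^sup>+\<^sup>1\<close> with \<open>n = CARD('n)\<close>.  In \<open>(w, z)\<close> the \<open>X\<^sub>i\<close>-coordinate is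
  \<open>w $ Inl i\<close>, the \<open>Y\<^sub>i\<close>-coordinate is \<open>w $ Inr i\<close>, and \<open>z\<close> is the \<open>Z\<close>-coordinate.  The same type
  serves for the Lie algebra and, via the exponential map, for the group; the topology and the
  (real) differentiable structure are the usual ones of the type.  The projection onto the first
  layer is \<^const>\<open>fst\<close>.
\<close>
type_synonym 'n cheis = "(complex, 'n + 'n) vec \<times> complex"

definition heis_bracket :: "'n::finite cheis \<Rightarrow> 'n cheis \<Rightarrow> 'n cheis" where
  "heis_bracket p q =
     (0, \<Sum>i\<in>UNIV. fst p $ Inl i * fst q $ Inr i - fst p $ Inr i * fst q $ Inl i)"

text \<open>
  The Baker-Campbell-Hausdorff product; the series stops after the first bracket because the
  algebra is two-step nilpotent.  The inverse of \<open>p\<close> is \<open>- p\<close>.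
\<close>
definition heis_mult :: "'n::finite cheis \<Rightarrow> 'n cheis \<Rightarrow> 'n cheis" where
  "heis_mult p q = p + q + (1 / 2) *\<^sub>R heis_bracket p q"

text \<open>
  The left Maurer-Cartan form: it sends a tangent vector \<open>u\<close> at \<open>p\<close> to the tangent vector at the
  identity that the differential of left translation by \<open>p\<close> maps to \<open>u\<close>.
\<close>
definition heis_mc :: "'n::finite cheis \<Rightarrow> 'n cheis \<Rightarrow> 'n cheis" where
  "heis_mc p u = frechet_derivative (heis_mult (- p)) (at p) u"

definition real_inner_product :: "('a::real_vector \<Rightarrow> 'a \<Rightarrow> real) \<Rightarrow> bool" where
  "real_inner_product g \<longleftrightarrow>
     bilinear g \<and> (\<forall>x y. g x y = g y x) \<and> (\<forall>x. x \<noteq> 0 \<longrightarrow> g x x > 0)"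

text \<open>
  The left invariant distribution determined by the first layer \<open>V\<^sub>1 = \<complex>\<^sup>2\<^sup>n \<times> {0}\<close>, and the norm on it
  of the left invariant inner product with value \<open>g\<close> on \<open>V\<^sub>1\<close>.
\<close>
definition horizontal_vector :: "'n::finite cheis \<Rightarrow> 'n cheis \<Rightarrow> bool" where
  "horizontal_vector p u \<longleftrightarrow> snd (heis_mc p u) = 0"

definition horizontal_norm ::
    "((complex, 'n + 'n) vec \<Rightarrow> (complex, 'n + 'n) vec \<Rightarrow> real) \<Rightarrow>
     'n::finite cheis \<Rightarrow> 'n cheis \<Rightarrow> real" where
  "horizontal_norm g p u = (let v = fst (heis_mc p u) in sqrt (g v v))"

definition horizontal_curve :: "(real \<Rightarrow> 'n::finite cheis) \<Rightarrow> bool" where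
  "horizontal_curve \<gamma> \<longleftrightarrow>
     valid_path \<gamma> \<and>
     (\<exists>S. finite S \<and>
        (\<forall>t\<in>{0..1} - S. horizontal_vector (\<gamma> t) (vector_derivative \<gamma> (at t))))"

text \<open>
  \<^const>\<open>valid_path\<close> (piecewise \<open>C\<^sup>1\<close>) allows the derivative to be unbounded near the finitely many exceptional
  parameters.  A curve whose speed is not integrable has infinite length and must be excluded,
  since \<^const>\<open>integral\<close> would give it length 0.
\<close>
definition carnot_dist ::
    "((complex, 'n + 'n) vec \<Rightarrow> (complex, 'n + 'n) vec \<Rightarrow> real) \<Rightarrow>
     'n::finite cheis \<Rightarrow> 'n cheis \<Rightarrow> real" where
  "carnot_dist g p q =
     Inf {l. \<exists>\<gamma>. horizontal_curve \<gamma> \<and> pathstart \<gamma> = p \<and> pathfinish \<gamma> = q \<and>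
            ((\<lambda>t. horizontal_norm g (\<gamma> t) (vector_derivative \<gamma> (at t))) has_integral l) {0..1}}"

text \<open>
  Quasiconformality of a self-homeomorphism of the metric space \<open>(UNIV, d)\<close>.  The distortion
  quotient is formed in the extended reals, so the suprema always exist and a positive number
  divided by 0 is \<open>\<infinity>\<close>.
\<close>
definition quasiconformal :: "('a \<Rightarrow> 'a \<Rightarrow> real) \<Rightarrow> ('a \<Rightarrow> 'a) \<Rightarrow> bool" where
  "quasiconformal d F \<longleftrightarrow>
     homeomorphic_map (Metric_space.mtopology UNIV d) (Metric_space.mtopology UNIV d) F \<and>
     (\<exists>H::real. \<forall>x.
        Limsup (at_right 0)
          (\<lambda>r. (SUP y\<in>{y. d x y \<le> r}. ereal (d (F x) (F y))) /
               (INF y\<in>{y. d x y \<ge> r}. ereal (d (F x) (F y)))) \<le> ereal H)"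

text \<open>Twice continuously differentiable in the real sense, with the derivatives as bounded linear maps.\<close>
definition C2_map :: "('a::real_normed_vector \<Rightarrow> 'b::real_normed_vector) \<Rightarrow> bool" where
  "C2_map F \<longleftrightarrow>
     (\<exists>(F' :: 'a \<Rightarrow> 'a \<Rightarrow>\<^sub>L 'b) (F'' :: 'a \<Rightarrow> 'a \<Rightarrow>\<^sub>L 'a \<Rightarrow>\<^sub>L 'b).
        (\<forall>x. (F has_derivative blinfun_apply (F' x)) (at x)) \<and>
        (\<forall>x. (F' has_derivative blinfun_apply (F'' x)) (at x)) \<and>
        continuous_on UNIV F'')"

definition C2_diffeomorphism :: "('a::real_normed_vector \<Rightarrow> 'b::real_normed_vector) \<Rightarrow> bool" where
  "C2_diffeomorphism F \<longleftrightarrow> bij F \<and> C2_map F \<and> C2_map (inv F)"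

definition is_lifting ::
    "('n::finite cheis \<Rightarrow> 'n cheis) \<Rightarrow> ((complex, 'n + 'n) vec \<Rightarrow> (complex, 'n + 'n) vec) \<Rightarrow> bool" where
  "is_lifting F f \<longleftrightarrow> (\<forall>p. F ` (fst -` {p}) = fst -` {f p})"

definition heis_conj :: "'n::finite cheis \<Rightarrow> 'n cheis" where
  "heis_conj p = ((\<chi> j. cnj (fst p $ j)), cnj (snd p))"

definition heis_scale :: "complex \<Rightarrow> 'n::finite cheis \<Rightarrow> 'n cheis" where
  "heis_scale c p = (c *s fst p, c * snd p)"

definition complex_affine :: "(complex \<Rightarrow> 'a::ab_group_add \<Rightarrow> 'a) \<Rightarrow> ('a \<Rightarrow> 'a) \<Rightarrow> bool" where
  "complex_affine s f \<longleftrightarrow> (\<exists>L b. Vector_Spaces.linear s s L \<and> (\<forall>p. f p = L p + b))"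

end

(*
  Horizontal and vertical displacements of Euclidean size t have Carnot length of order t and
  t^(1/2).  Comparing their images shows that F preserves the horizontal distribution; comparing
  the images of two horizontal displacements shows that the horizontal derivatives A of F have
  uniformly bounded distortion.  With omega the symplectic form on the first layer, antisymmetrising
  the derivative of the contact equation gives omega(A u, A v) = L(omega(u, v)) with L real
  linear, so A is complex linear or conjugate linear, by connectedness with the same choice at
  all points.

  In the complex linear case the commutators of horizontal fields make the first layer component
  of F holomorphic, and L is multiplication by a holomorphic function mu without zeros.  The
  distortion bound makes A_ij A_kl / mu bounded, hence constant by Liouville, so A = h A(0) with h
  holomorphic and nowhere 0.  The commutation relations force h to be affine along every
  horizontal complex line; as it has no zero, it is constant, and F is affine.
*)
theory Submission
  imports Defs "HOL-Complex_Analysis.Cauchy_Integral_Formula"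
begin

text \<open>Contact alone gives no rigidity: the shear (x, y) -> (x, y + x^2) in one symplectic
  plane lifts to a polynomial contact diffeomorphism that is not affine. So quasiconformality is
  used twice: qualitatively, for the contact property, and quantitatively, through one distortion
  constant for all points, which is what Liouville needs.

  At the outset \<open>A\<close> is only of class C^1 in the real sense. Hence holomorphy is always
  restricted to complex lines, where a complex derivative at each point suffices. Complex linearity
  of \<open>A\<close> covers the horizontal directions; the vertical one is a bracket of these.

  That h is affine along horizontal lines has the following reason. Write X_u for the horizontal
  field of u and Z for the vertical one, and let zeta be Z applied to the first layer of F, pulled
  back by A(0). The relation [X_u, X_v] = omega(u, v) Z makes X_u h a symplectic pairing of u with
  zeta; [Z, X_u] = 0 gives X_u zeta = (Z h) u. So X_u X_u h pairs u with itself and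
  vanishes.\<close>

section \<open>The symplectic form and the contact form\<close>

text \<open>The standard complex symplectic form:
  \<open>heis_bracket p q = (0, sform (fst p) (fst q))\<close>.\<close>

definition sform :: "(complex, 'n::finite + 'n) vec \<Rightarrow> (complex, 'n + 'n) vec \<Rightarrow> complex" where
  "sform u v = (\<Sum>i\<in>UNIV. u $ Inl i * v $ Inr i - u $ Inr i * v $ Inl i)"

lemma bilinear_sform: "bilinear sform"
  unfolding bilinear_def sform_def
  by (auto intro!: linearI simp: algebra_simps sum.distrib sum_subtractf scaleR_sum_right
      simp del: sum_subtractf) (auto simp: sum_subtractf sum.distrib algebra_simps)

lemma bounded_bilinear_sform: "bounded_bilinear sform"
  using bilinear_sform by (simp add: bilinear_conv_bounded_bilinear)

interpretation sform: bounded_bilinear sform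
  by (rule bounded_bilinear_sform)

lemma sform_scale_left [simp]: "sform (c *s u) v = c * sform u v"
  by (simp add: sform_def sum_distrib_left algebra_simps)

lemma sform_scale_right [simp]: "sform u (c *s v) = c * sform u v"
  by (simp add: sform_def sum_distrib_left algebra_simps)

lemma sform_commute: "sform u v = - sform v u"
  unfolding sform_def sum_negf [symmetric] by (simp add: mult.commute)

lemma sform_self [simp]: "sform u u = 0"
  by (simp add: sform_def mult.commute)

definition cnj_vec :: "(complex, 'i::finite) vec \<Rightarrow> (complex, 'i) vec" where
  "cnj_vec u = (\<chi> j. cnj (u $ j))"

lemma cnj_vec_nth [simp]: "cnj_vec u $ j = cnj (u $ j)"
  by (simp add: cnj_vec_def)

lemma norm_cnj_vec [simp]: "norm (cnj_vec u) = norm u"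
  by (simp add: norm_vec_def)

lemma norm_vec_scale: "norm (c *s (u :: (complex, 'i::finite) vec)) = norm c * norm u"
  by (simp add: norm_vec_def norm_mult L2_set_right_distrib)

lemma cnj_vec_cnj_vec [simp]: "cnj_vec (cnj_vec u) = u"
  by (simp add: vec_eq_iff)

lemma linear_cnj_vec: "linear cnj_vec"
  by (rule linearI) (auto simp: vec_eq_iff)

lemma sform_cnj_vec: "sform (cnj_vec u) (cnj_vec v) = cnj (sform u v)"
  by (simp add: sform_def)

lemma sum_UNIV_Plus:
  "(\<Sum>j\<in>(UNIV :: ('a::finite + 'b::finite) set). f j) = (\<Sum>i\<in>UNIV. f (Inl i)) + (\<Sum>i\<in>UNIV. f (Inr i))"
  by (simp add: UNIV_Plus_UNIV [symmetric] sum.Plus del: UNIV_Plus_UNIV)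

lemma norm_vec_Plus_sq:
  "(norm (u :: (complex, 'n::finite + 'n) vec))\<^sup>2 = (\<Sum>i\<in>UNIV. (cmod (u $ Inl i))\<^sup>2 + (cmod (u $ Inr i))\<^sup>2)"
  by (simp add: norm_vec_def L2_set_def sum_UNIV_Plus sum_nonneg sum.distrib)

text \<open>The quaternionic structure (x, y) -> (- conj y, conj x) is an isometry that turns
  \<open>sform\<close> into the Hermitian product. Besides nondegeneracy it gives the sizes needed
  in \<open>norm_A_bound\<close>.\<close>

lemma sform_dual:
  fixes u :: "(complex, 'n::finite + 'n) vec"
  obtains v where "norm v = norm u" "sform u v = of_real ((norm u)\<^sup>2)"
proof
  define v :: "(complex, 'n + 'n) vec"
    where "v = (\<chi> j. case j of Inl i \<Rightarrow> - cnj (u $ Inr i) | Inr i \<Rightarrow> cnj (u $ Inl i))"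
  have v: "v $ Inl i = - cnj (u $ Inr i)" "v $ Inr i = cnj (u $ Inl i)" for i
    by (auto simp: v_def)
  have "(norm v)\<^sup>2 = (norm u)\<^sup>2"
    unfolding norm_vec_Plus_sq by (simp add: v add.commute)
  then show "norm v = norm u"
    by simp
  show "sform u v = of_real ((norm u)\<^sup>2)"
    unfolding norm_vec_Plus_sq sform_def
    by (simp add: v complex_norm_square del: of_real_power)
qed

lemma sform_axis_Inl [simp]: "sform (axis (Inl i) 1) v = v $ Inr i"
  and sform_axis_Inr [simp]: "sform (axis (Inr i) 1) v = - (v $ Inl i)"
proof -
  have "sform (axis (Inl i) 1) v = (\<Sum>k\<in>UNIV. if k = i then v $ Inr k else 0)"
    unfolding sform_def by (intro sum.cong) (auto simp: axis_def)
  then show "sform (axis (Inl i) 1) v = v $ Inr i" by simp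
  have "sform (axis (Inr i) 1) v = (\<Sum>k\<in>UNIV. if k = i then - (v $ Inl k) else 0)"
    unfolding sform_def by (intro sum.cong) (auto simp: axis_def)
  then show "sform (axis (Inr i) 1) v = - (v $ Inl i)" by simp
qed

text \<open>The value at \<open>q\<close> of the left invariant field whose value at the identity is
  \<open>(v, 0)\<close>.\<close>

definition horiz :: "'n::finite cheis \<Rightarrow> (complex, 'n + 'n) vec \<Rightarrow> 'n cheis" where
  "horiz q v = (v, sform (fst q) v / 2)"

text \<open>The vertical component of the Maurer-Cartan form (\<open>heis_mc_eq\<close>). Since
  \<open>sform\<close> is alternating, \<open>contact_form p (q - p)\<close> is also the last
  coordinate of the group element \<open>heis_mult (- p) q\<close>; in this role it enters the
  distance estimates.\<close>

definition contact_form :: "'n::finite cheis \<Rightarrow> 'n cheis \<Rightarrow> complex" where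
  "contact_form p a = snd a - sform (fst p) (fst a) / 2"

lemma fst_horiz [simp]: "fst (horiz q v) = v" and snd_horiz [simp]: "snd (horiz q v) = sform (fst q) v / 2"
  by (simp_all add: horiz_def)

text \<open>Since \<open>sform v v = 0\<close>, a straight line that starts in direction
  \<open>horiz q v\<close> stays tangent to the field, so the integral curves of these fields are
  straight lines.\<close>

lemma horiz_fst_add [simp]: "horiz (q + r *\<^sub>R horiz q v) v = horiz q v"
  by (simp add: horiz_def sform.add_left sform.scaleR_left)

lemma linear_horiz: "linear (horiz q)"
  by (rule linearI) (auto simp: horiz_def sform.add_right sform.scaleR_right add_divide_distrib scaleR_conv_of_real[where 'a=complex])

lemma linear_contact_form: "linear (contact_form p)"
  by (rule linearI) (auto simp: contact_form_def sform.add_right sform.scaleR_right algebra_simps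
      add_divide_distrib scaleR_conv_of_real[where 'a=complex])

lemma contact_form_horiz [simp]: "contact_form q (horiz q v) = 0"
  by (simp add: contact_form_def)

lemma contact_form_eq_0: "contact_form q a = 0 \<longleftrightarrow> a = horiz q (fst a)"
  by (auto simp: contact_form_def horiz_def prod_eq_iff)

lemma horiz_decomp: "a = horiz q (fst a) + (0, contact_form q a)"
  by (simp add: contact_form_def horiz_def prod_eq_iff)

lemma heis_mc_eq: "heis_mc p u = (fst u, contact_form p u)"
proof -
  define \<Lambda> where "\<Lambda> u = (fst u, contact_form p u)" for u
  \<comment> \<open>Left translations are affine in these coordinates, so the derivative is the
    linear part.\<close>
  have mult: "heis_mult (- p) = (\<lambda>q. \<Lambda> q - p)"
  proof
    fix q
    have "heis_bracket (- p) q = (0, - sform (fst p) (fst q))"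
      by (simp add: heis_bracket_def sform_def sum_negf [symmetric])
    then show "heis_mult (- p) q = \<Lambda> q - p"
      by (simp add: heis_mult_def \<Lambda>_def contact_form_def prod_eq_iff scaleR_conv_of_real [where 'a = complex])
  qed
  have "linear \<Lambda>"
    using linear_contact_form [of p] by (auto simp: \<Lambda>_def linear_iff)
  then have "bounded_linear \<Lambda>"
    by (simp add: linear_conv_bounded_linear)
  then have "(heis_mult (- p) has_derivative \<Lambda>) (at p)"
    unfolding mult using has_derivative_diff [OF bounded_linear_imp_has_derivative has_derivative_const] by fastforce
  then show ?thesis
    unfolding heis_mc_def by (simp add: frechet_derivative_at [symmetric] \<Lambda>_def)
qed

lemma horizontal_vector_iff: "horizontal_vector p u \<longleftrightarrow> contact_form p u = 0"
  by (simp add: horizontal_vector_def heis_mc_eq)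

lemma horizontal_norm_eq: "horizontal_norm g p u = sqrt (g (fst u) (fst u))"
  by (simp add: horizontal_norm_def heis_mc_eq Let_def)

section \<open>Symmetry of second derivatives\<close>

text \<open>The mean value theorem in direction \<open>a\<close> for the difference
  \<open>\<phi>\<close> along two parallel segments leaves values of \<open>f'\<close> at two points
  near \<open>x\<close>. Expanding both to first order at \<open>x\<close> costs an error of
  \<open>e\<close> times the displacement each, whence the factor 2.\<close>

lemma second_difference_bound:
  fixes f :: "'a::real_normed_vector \<Rightarrow> 'b::real_inner"
  assumes f: "\<And>x. (f has_derivative f' x) (at x)"
    and f': "((\<lambda>x. f' x a) has_derivative (\<lambda>h. f'' h a)) (at x)"
    and "e > 0"
  shows "eventually (\<lambda>t. norm (f (x + t *\<^sub>R a + t *\<^sub>R b) - f (x + t *\<^sub>R a) - f (x + t *\<^sub>R b) + f x - t\<^sup>2 *\<^sub>R f'' b a)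
            \<le> 2 * e * t\<^sup>2 * (norm a + norm b)) (at_right (0::real))"
proof -
  from f' \<open>e > 0\<close> obtain d where "d > 0" and d:
    "\<And>y. norm (y - x) < d \<Longrightarrow> norm (f' y a - f' x a - f'' (y - x) a) \<le> e * norm (y - x)"
    unfolding has_derivative_at_alt by blast
  interpret f'': bounded_linear "\<lambda>h. f'' h a"
    using f' by (rule has_derivative_bounded_linear)
  define M where "M = norm a + norm b + 1"
  have "M > 0" by (simp add: M_def add_nonneg_pos)
  have "eventually (\<lambda>t. t < d / M) (at_right (0::real))"
    using order_tendstoD(2)[OF tendsto_ident_at, of 0 "d / M" "{0<..}"] \<open>d > 0\<close> \<open>M > 0\<close> by simp
  moreover have "eventually (\<lambda>t. t > 0) (at_right (0::real))"
    by (simp add: eventually_at_right_less)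
  ultimately show ?thesis
  proof eventually_elim
    case (elim t)
    have tM: "t * M < d" using elim \<open>M > 0\<close> by (simp add: field_simps)
    define \<phi> where "\<phi> s = f (x + s *\<^sub>R a + t *\<^sub>R b) - f (x + s *\<^sub>R a) - (s * t) *\<^sub>R f'' b a" for s
    define \<phi>' where "\<phi>' s h = h *\<^sub>R (f' (x + s *\<^sub>R a + t *\<^sub>R b) a - f' (x + s *\<^sub>R a) a - t *\<^sub>R f'' b a)" for s h :: real
    have lin: "f' y (h *\<^sub>R a) = h *\<^sub>R f' y a" for y h
      using f[of y] by (simp add: has_derivative_bounded_linear linear_simps)
    have D: "(\<phi> has_derivative \<phi>' s) (at s)" for s
    proof -
      have 1: "((\<lambda>s. f (x + s *\<^sub>R a + t *\<^sub>R b)) has_derivative (\<lambda>h. f' (x + s *\<^sub>R a + t *\<^sub>R b) (h *\<^sub>R a))) (at s)"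
        by (rule has_derivative_compose[OF _ f]) (auto intro!: derivative_eq_intros)
      have 2: "((\<lambda>s. f (x + s *\<^sub>R a)) has_derivative (\<lambda>h. f' (x + s *\<^sub>R a) (h *\<^sub>R a))) (at s)"
        by (rule has_derivative_compose[OF _ f]) (auto intro!: derivative_eq_intros)
      have 3: "((\<lambda>s. (s * t) *\<^sub>R f'' b a) has_derivative (\<lambda>h. (h * t) *\<^sub>R f'' b a)) (at s)"
        by (auto intro!: derivative_eq_intros)
      show ?thesis unfolding \<phi>_def [abs_def]
        by (rule has_derivative_eq_rhs[OF has_derivative_diff[OF has_derivative_diff[OF 1 2] 3]])
          (simp add: \<phi>'_def lin fun_eq_iff scaleR_diff_right)
    qed
    have "\<exists>s\<in>{0<..<t}. norm (\<phi> t - \<phi> 0) \<le> norm (\<phi>' s (t - 0))"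
    proof (rule mvt_general)
      show "continuous_on {0..t} \<phi>"
        using D by (meson continuous_at_imp_continuous_on has_derivative_continuous)
    qed (use elim D in auto)
    then obtain s where s: "0 < s" "s < t" "norm (\<phi> t - \<phi> 0) \<le> norm (\<phi>' s t)" by auto
    have n1: "norm (s *\<^sub>R a + t *\<^sub>R b) \<le> t * (norm a + norm b)"
      using s elim by (intro norm_triangle_le) (auto simp: distrib_left intro!: add_mono mult_right_mono)
    have n2: "norm (s *\<^sub>R a) \<le> t * (norm a + norm b)"
      using s elim by (auto simp: distrib_left intro!: add_increasing2 mult_right_mono)
    have n3: "t * (norm a + norm b) < d"
      using tM elim by (simp add: M_def algebra_simps)
    have b1: "norm (f' (x + (s *\<^sub>R a + t *\<^sub>R b)) a - f' x a - f'' (s *\<^sub>R a + t *\<^sub>R b) a) \<le> e * (t * (norm a + norm b))"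
      using d[of "x + (s *\<^sub>R a + t *\<^sub>R b)"] n1 n3 \<open>e > 0\<close>
      by (smt (verit) add_diff_cancel_left' mult_left_mono)
    have b2: "norm (f' (x + s *\<^sub>R a) a - f' x a - f'' (s *\<^sub>R a) a) \<le> e * (t * (norm a + norm b))"
      using d[of "x + (s *\<^sub>R a)"] n2 n3 \<open>e > 0\<close>
      by (smt (verit) add_diff_cancel_left' mult_left_mono)
    have "norm (f' (x + s *\<^sub>R a + t *\<^sub>R b) a - f' (x + s *\<^sub>R a) a - t *\<^sub>R f'' b a) \<le> 2 * e * t * (norm a + norm b)"
    proof -
      have "f' (x + s *\<^sub>R a + t *\<^sub>R b) a - f' (x + s *\<^sub>R a) a - t *\<^sub>R f'' b a
         = (f' (x + (s *\<^sub>R a + t *\<^sub>R b)) a - f' x a - f'' (s *\<^sub>R a + t *\<^sub>R b) a)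
           - (f' (x + s *\<^sub>R a) a - f' x a - f'' (s *\<^sub>R a) a)"
        by (simp add: f''.add f''.scaleR algebra_simps)
      then show ?thesis using norm_triangle_le_diff[OF add_mono[OF b1 b2]] by (simp add: algebra_simps)
    qed
    then have "norm (\<phi>' s t) \<le> t * (2 * e * t * (norm a + norm b))"
      unfolding \<phi>'_def using elim by (simp add: mult_left_mono)
    with s have "norm (\<phi> t - \<phi> 0) \<le> 2 * e * t\<^sup>2 * (norm a + norm b)"
      by (simp add: power2_eq_square algebra_simps)
    then show ?case
      by (simp add: \<phi>_def power2_eq_square algebra_simps)
  qed
qed

text \<open>The second difference does not change when \<open>a\<close> and \<open>b\<close> are
  swapped, so its two expansions must have the same leading coefficient.\<close>

lemma second_derivative_symmetric:
  fixes f :: "'a::real_normed_vector \<Rightarrow> 'b::real_inner"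
  assumes f: "\<And>x. (f has_derivative f' x) (at x)"
    and f': "\<And>v. ((\<lambda>x. f' x v) has_derivative (\<lambda>h. f'' h v)) (at x)"
  shows "f'' a b = f'' b a"
proof -
  have bound: "norm (f'' a b - f'' b a) \<le> 4 * (norm a + norm b) * e" if "e > 0" for e
  proof -
    have "eventually (\<lambda>t. t > 0) (at_right (0::real))"
      by (simp add: eventually_at_right_less)
    with second_difference_bound[OF f f' that, where a=a and b=b] second_difference_bound[OF f f' that, where a=b and b=a]
    have "eventually (\<lambda>t. norm (f'' a b - f'' b a) \<le> 4 * (norm a + norm b) * e) (at_right (0::real))"
    proof eventually_elim
      case (elim t)
      have "norm (t\<^sup>2 *\<^sub>R (f'' a b - f'' b a)) \<le> 4 * e * t\<^sup>2 * (norm a + norm b)"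
        using norm_triangle_le_diff[OF add_mono[OF elim(1,2)]] by (simp add: algebra_simps)
      then have "t\<^sup>2 * norm (f'' a b - f'' b a) \<le> t\<^sup>2 * (4 * (norm a + norm b) * e)"
        by (simp add: ring_distribs mult_ac)
      then show ?case using elim(3) by (simp only: mult_le_cancel_left_pos zero_less_power)
    qed
    then show ?thesis
      by (simp add: eventually_const_iff)
  qed
  have "norm (f'' a b - f'' b a) \<le> 0 + e" if "e > 0" for e
  proof -
    define m where "m = 4 * (norm a + norm b)"
    have "m \<ge> 0" by (simp add: m_def)
    then have "m * (e / (m + 1)) \<le> e"
      using that by (simp add: field_simps)
    moreover have "norm (f'' a b - f'' b a) \<le> m * (e / (m + 1))"
      using bound [of "e / (m + 1)"] that \<open>m \<ge> 0\<close> unfolding m_def [symmetric] by simp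
    ultimately show ?thesis by simp
  qed
  then have "norm (f'' a b - f'' b a) \<le> 0"
    by (rule field_le_epsilon)
  then show ?thesis by simp
qed

section \<open>Two-sided bounds for the Carnot distance\<close>

lemma real_inner_product_bounds:
  fixes g :: "'a::euclidean_space \<Rightarrow> 'a \<Rightarrow> real"
  assumes "real_inner_product g"
  obtains c C where "0 < c" "0 < C" "\<And>v. c * norm v \<le> sqrt (g v v)" "\<And>v. sqrt (g v v) \<le> C * norm v"
proof -
  have bil: "bilinear g" and pos: "\<And>v. v \<noteq> 0 \<Longrightarrow> g v v > 0"
    using assms by (auto simp: real_inner_product_def)
  interpret bounded_bilinear g
    using bil by (simp add: bilinear_conv_bounded_bilinear)
  obtain B where B: "B > 0" "\<And>x y. norm (g x y) \<le> norm x * norm y * B"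
    using pos_bounded by blast
  have "sqrt (g v v) \<le> sqrt B * norm v" for v
  proof -
    have "g v v \<le> B * (norm v)\<^sup>2"
      using B(2)[of v v] by (simp add: power2_eq_square mult_ac)
    then have "sqrt (g v v) \<le> sqrt (B * (norm v)\<^sup>2)"
      by (rule real_sqrt_le_mono)
    then show ?thesis by (simp add: real_sqrt_mult)
  qed
  moreover
  have "\<exists>x\<in>sphere 0 1. \<forall>y\<in>sphere (0::'a) 1. g x x \<le> g y y"
  proof (rule continuous_attains_inf)
    show "sphere (0::'a) 1 \<noteq> {}"
      using SOME_Basis norm_Basis by fastforce
    show "continuous_on (sphere 0 1) (\<lambda>x. g x x)"
      by (intro continuous_on continuous_intros)
  qed simp
  then obtain x where x: "norm x = 1" "\<And>y. norm y = 1 \<Longrightarrow> g x x \<le> g y y"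
    by auto
  have "sqrt (g x x) * norm v \<le> sqrt (g v v)" for v
  proof (cases "v = 0")
    case False
    have "g x x \<le> g (v /\<^sub>R norm v) (v /\<^sub>R norm v)"
      using False by (intro x) simp
    also have "\<dots> = g v v / (norm v)\<^sup>2"
      by (simp add: scaleR_left scaleR_right power2_eq_square divide_inverse)
    finally have "g x x * (norm v)\<^sup>2 \<le> g v v"
      using False by (simp add: field_simps)
    then have "sqrt (g x x * (norm v)\<^sup>2) \<le> sqrt (g v v)"
      by (rule real_sqrt_le_mono)
    then show ?thesis by (simp add: real_sqrt_mult)
  qed (simp add: zero_left)
  moreover have "sqrt (g x x) > 0"
    using pos[of x] x(1) by fastforce
  ultimately show ?thesis
    using that[of "sqrt (g x x)" "sqrt B"] B(1) by simp
qed

text \<open>The first argument is the position on a curve and the second its velocity, with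
  \<open>r' = 1\<close>. The coefficients are the Wronskians of the profiles, as
  \<open>sform\<close> is alternating.\<close>

lemma sform_combination:
  "sform (p + r *\<^sub>R w + \<phi> *\<^sub>R u + \<psi> *\<^sub>R v) (w + \<phi>' *\<^sub>R u + \<psi>' *\<^sub>R v) =
   sform p (w + \<phi>' *\<^sub>R u + \<psi>' *\<^sub>R v) + (r * \<phi>' - \<phi>) *\<^sub>R sform w u
     + (r * \<psi>' - \<psi>) *\<^sub>R sform w v + (\<phi> * \<psi>' - \<psi> * \<phi>') *\<^sub>R sform u v"
  using sform_commute[of u w] sform_commute[of v w] sform_commute[of v u]
  by (simp add: sform.add_left sform.scaleR_left sform.add_right sform.scaleR_right
      scaleR_conv_of_real [where 'a = complex] algebra_simps)

definition carnot_lengths ::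
    "((complex, 'n + 'n) vec \<Rightarrow> (complex, 'n + 'n) vec \<Rightarrow> real) \<Rightarrow>
     'n::finite cheis \<Rightarrow> 'n cheis \<Rightarrow> real set" where
  "carnot_lengths g p q =
     {l. \<exists>\<gamma>. horizontal_curve \<gamma> \<and> pathstart \<gamma> = p \<and> pathfinish \<gamma> = q \<and>
            ((\<lambda>t. horizontal_norm g (\<gamma> t) (vector_derivative \<gamma> (at t))) has_integral l) {0..1}}"

lemma carnot_dist_eq_Inf: "carnot_dist g p q = Inf (carnot_lengths g p q)"
  by (simp add: carnot_dist_def carnot_lengths_def)

locale carnot_metric =
  fixes g :: "(complex, 'n::finite + 'n) vec \<Rightarrow> (complex, 'n + 'n) vec \<Rightarrow> real"
    and c C :: real
  assumes ip: "real_inner_product g" and c: "c > 0" and C: "C > 0"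
    and g_lower: "c * norm v \<le> sqrt (g v v)" and g_upper: "sqrt (g v v) \<le> C * norm v"
begin

lemma g_nonneg: "0 \<le> g v v"
  using g_lower[of v] c by (smt (verit) mult_nonneg_nonneg norm_ge_zero real_sqrt_lt_0_iff)

lemma continuous_on_speed:
  assumes "continuous_on S f"
  shows "continuous_on S (\<lambda>t. sqrt (g (f t) (f t)))"
proof -
  have "bounded_bilinear g"
    using ip by (simp add: bilinear_conv_bounded_bilinear real_inner_product_def)
  then show ?thesis
    using assms by (intro continuous_on_real_sqrt bounded_bilinear.continuous_on[of g])
qed

lemma carnot_lengths_curve:
  fixes \<gamma> :: "real \<Rightarrow> 'n cheis"
  assumes \<gamma>: "\<And>t. (\<gamma> has_vector_derivative \<gamma>' t) (at t)" and cont: "continuous_on UNIV \<gamma>'"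
    and hor: "\<And>t. contact_form (\<gamma> t) (\<gamma>' t) = 0"
    and M: "\<And>t. 0 \<le> t \<Longrightarrow> t \<le> 1 \<Longrightarrow> norm (fst (\<gamma>' t)) \<le> M"
  shows "\<exists>l\<in>carnot_lengths g (\<gamma> 0) (\<gamma> 1). l \<le> C * M"
proof -
  have vd: "vector_derivative \<gamma> (at t) = \<gamma>' t" for t
    using \<gamma> by (rule vector_derivative_at)
  have "\<gamma> C1_differentiable_on {0..1}"
    unfolding C1_differentiable_on_def using \<gamma> cont continuous_on_subset by blast
  then have "horizontal_curve \<gamma>"
    unfolding horizontal_curve_def valid_path_def
    by (auto intro: C1_differentiable_imp_piecewise exI[of _ "{}"] simp: vd horizontal_vector_iff hor)
  have "continuous_on {0..1} (\<lambda>t. sqrt (g (fst (\<gamma>' t)) (fst (\<gamma>' t))))"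
    by (intro continuous_on_speed continuous_on_fst continuous_on_subset[OF cont]) auto
  then obtain l where l: "((\<lambda>t. sqrt (g (fst (\<gamma>' t)) (fst (\<gamma>' t)))) has_integral l) {0..1}"
    using integrable_continuous_real by blast
  moreover have "((\<lambda>t::real. C * M) has_integral C * M) {0..1}"
    using has_integral_const_real[of "C * M" 0 1] by simp
  ultimately have "l \<le> C * M"
    by (rule has_integral_le) (use M C in \<open>auto intro!: order_trans[OF g_upper] mult_left_mono\<close>)
  moreover have "l \<in> carnot_lengths g (\<gamma> 0) (\<gamma> 1)"
    unfolding carnot_lengths_def using \<open>horizontal_curve \<gamma>\<close> l
    by (auto intro!: exI[of _ \<gamma>] simp: pathstart_def pathfinish_def horizontal_norm_eq vd)
  ultimately show ?thesis by blast
qed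

text \<open>The vertical bound is a symplectic area: along a horizontal curve the derivative of
  \<open>contact_form p (\<gamma> t - p)\<close> is half of \<open>sform\<close> of displacement and
  velocity in the first layer. Both factors are controlled by the length, hence the square.\<close>

lemma carnot_lengths_lower:
  assumes "l \<in> carnot_lengths g p q"
    and B: "\<And>u v :: (complex, 'n + 'n) vec. norm (sform u v) \<le> B * norm u * norm v"
  shows "0 \<le> l" "norm (fst q - fst p) \<le> l / c" "norm (contact_form p (q - p)) \<le> B * (l / c)\<^sup>2"
proof -
  obtain \<gamma> where h: "horizontal_curve \<gamma>" and pq: "\<gamma> 0 = p" "\<gamma> 1 = q" and
    "((\<lambda>t. horizontal_norm g (\<gamma> t) (vector_derivative \<gamma> (at t))) has_integral l) {0..1}"
    using assms unfolding carnot_lengths_def pathstart_def pathfinish_def by blast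
  then have "((\<lambda>t. sqrt (g (fst (vector_derivative \<gamma> (at t))) (fst (vector_derivative \<gamma> (at t))))) has_integral l) {0..1}"
    by (simp add: horizontal_norm_eq)
  moreover define v where "v t = vector_derivative \<gamma> (at t)" for t
  moreover define s where "s t = sqrt (g (fst (v t)) (fst (v t)))" for t
  ultimately have l: "(s has_integral l) {0..1}"
    by (simp add: s_def [abs_def] v_def)
  have s_nonneg: "0 \<le> s t" for t
    by (simp add: s_def g_nonneg)
  have v_s: "norm (fst (v t)) \<le> s t / c" for t
    using g_lower[of "fst (v t)"] c by (simp add: s_def field_simps)
  show "0 \<le> l"
    using l s_nonneg by (rule has_integral_nonneg)
  from h obtain S0 S1 D where "finite S0" "finite S1" and cont: "continuous_on {0..1} \<gamma>"
    and hor: "\<And>t. t \<in> {0..1} - S0 \<Longrightarrow> contact_form (\<gamma> t) (v t) = 0"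
    and D: "\<And>t. t \<in> {0..1} - S1 \<Longrightarrow> (\<gamma> has_vector_derivative D t) (at t)"
    unfolding horizontal_curve_def valid_path_def piecewise_C1_differentiable_on_def
      C1_differentiable_on_def v_def horizontal_vector_iff by blast
  define S where "S = S0 \<union> S1"
  have S: "finite S" using \<open>finite S0\<close> \<open>finite S1\<close> by (simp add: S_def)
  have hor: "contact_form (\<gamma> t) (v t) = 0" and der: "(\<gamma> has_vector_derivative v t) (at t)"
    if "t \<in> {0..1} - S" for t
    using that hor[of t] D[of t] vector_derivative_at[OF D[of t]] by (auto simp: S_def v_def)
  have W: "norm (fst (\<gamma> x) - fst p) \<le> l / c" if "x \<in> {0..1}" for x
  proof -
    have sx: "s integrable_on {0..x}"
      using l that by (auto intro: integrable_subinterval_real)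
    have *: "((\<lambda>t. fst (v t)) has_integral (fst (\<gamma> x) - fst (\<gamma> 0))) {0..x}"
    proof (rule fundamental_theorem_of_calculus_interior_strong[OF S])
      show "continuous_on {0..x} (\<lambda>t. fst (\<gamma> t))"
        using that by (intro continuous_on_fst continuous_on_subset[OF cont]) auto
    qed (use that in \<open>auto intro!: bounded_linear.has_vector_derivative[OF bounded_linear_fst] der\<close>)
    have "norm (integral {0..x} (\<lambda>t. fst (v t))) \<le> integral {0..x} (\<lambda>t. s t / c)"
      using * sx v_s by (intro integral_norm_bound_integral) (auto intro: integrable_on_divide)
    also have "\<dots> = integral {0..x} s / c" by simp
    also have "integral {0..x} s \<le> integral {0..1} s"
      using that l s_nonneg sx by (intro integral_subset_le) auto
    finally show ?thesis
      using integral_unique[OF *] integral_unique[OF l] c by (simp add: pq divide_right_mono)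
  qed
  from W[of 1] show "norm (fst q - fst p) \<le> l / c"
    by (simp add: pq)
  have B0: "B \<ge> 0"
    using order_trans[OF norm_ge_zero B[of "axis undefined 1" "axis undefined 1"]] by simp
  have *: "((\<lambda>t. sform (fst (\<gamma> t) - fst p) (fst (v t)) / 2) has_integral
      contact_form p (\<gamma> 1 - p) - contact_form p (\<gamma> 0 - p)) {0..1}"
  proof (rule fundamental_theorem_of_calculus_interior_strong[OF S])
    have bl: "bounded_linear (contact_form p)"
      using linear_contact_form by (simp add: linear_conv_bounded_linear)
    show "continuous_on {0..1} (\<lambda>t. contact_form p (\<gamma> t - p))"
      by (intro bounded_linear.continuous_on[OF bl] continuous_intros cont)
    show "((\<lambda>t. contact_form p (\<gamma> t - p)) has_vector_derivative
        sform (fst (\<gamma> t) - fst p) (fst (v t)) / 2) (at t)" if "t \<in> {0<..<1} - S" for t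
    proof -
      have "((\<lambda>t. \<gamma> t - p) has_vector_derivative v t) (at t)"
        using der[of t] that by (auto intro!: derivative_eq_intros)
      then have "((\<lambda>t. contact_form p (\<gamma> t - p)) has_vector_derivative contact_form p (v t)) (at t)"
        by (rule bounded_linear.has_vector_derivative[OF bl])
      moreover have "contact_form p (v t) = sform (fst (\<gamma> t) - fst p) (fst (v t)) / 2"
        using hor[of t] that by (simp add: contact_form_def sform.diff_left field_simps)
      ultimately show ?thesis by simp
    qed
  qed simp
  have "norm (integral {0..1} (\<lambda>t. sform (fst (\<gamma> t) - fst p) (fst (v t)) / 2))
      \<le> integral {0..1} (\<lambda>t. B * (l / c) / c * s t)"
  proof (rule integral_norm_bound_integral)
    fix t :: real assume t: "t \<in> {0..1}"
    have "norm (sform (fst (\<gamma> t) - fst p) (fst (v t))) \<le> B * norm (fst (\<gamma> t) - fst p) * norm (fst (v t))"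
      by (rule B)
    also have "\<dots> \<le> B * (l / c) * (s t / c)"
      using B0 W[OF t] v_s[of t] by (intro mult_mono mult_left_mono mult_nonneg_nonneg) (auto simp: \<open>0 \<le> l\<close> c less_imp_le)
    finally have "norm (sform (fst (\<gamma> t) - fst p) (fst (v t))) \<le> B * (l / c) / c * s t"
      by simp
    moreover have "norm (x / 2) \<le> norm x" for x :: complex
      by (simp add: norm_divide)
    ultimately show "norm (sform (fst (\<gamma> t) - fst p) (fst (v t)) / 2) \<le> B * (l / c) / c * s t"
      by (rule order_trans [rotated])
  next
    show "(\<lambda>t. B * (l / c) / c * s t) integrable_on {0..1}"
      using l by (intro integrable_on_mult_right) auto
  qed (use * in auto)
  then show "norm (contact_form p (q - p)) \<le> B * (l / c)\<^sup>2"
    unfolding integral_unique[OF *] integral_mult_right integral_unique[OF l]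
    by (simp add: pq power2_eq_square linear_0[OF linear_contact_form])
qed

lemma carnot_lengths_upper:
  assumes B: "\<And>u v :: (complex, 'n + 'n) vec. norm (sform u v) \<le> B * norm u * norm v"
  shows "\<exists>l\<in>carnot_lengths g p q.
    l \<le> C * (391 + 65 * B) * (norm (fst q - fst p) + sqrt (norm (contact_form p (q - p))))"
proof -
  \<comment> \<open>The first layer component of the connecting curve is
    \<open>fst p + t w + (t - t\<^sup>2) u + (t - 3 t\<^sup>2 + 2 t\<^sup>3) v\<close> with \<open>u\<close>, \<open>v\<close> in a symplectic plane.
    The profile of \<open>v\<close> has mean 0, so the contact defect of the endpoint does not depend
    on \<open>sform w v\<close>, and \<open>b\<close> solves a linear equation.  If \<open>z = 0\<close>, then \<open>a = 0\<close> and \<open>b\<close>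
    involves a harmless division by 0.\<close>
  define w where "w = fst q - fst p"
  define z where "z = contact_form p (q - p)"
  define a where "a = sqrt (norm z)"
  define e :: "(complex, 'n + 'n) vec" where "e = axis (Inl undefined) 1"
  define f :: "(complex, 'n + 'n) vec" where "f = axis (Inr undefined) 1"
  define b where "b = - 30 * z / a - 5 * sform w e"
  define u where "u = a *\<^sub>R e"
  define v where "v = b *s f"
  have ef: "norm e = 1" "norm f = 1" "sform e f = 1"
    by (simp_all add: e_def f_def)
  \<comment> \<open>Up to the sign put on \<open>sform w u\<close>, the last three coefficients are
    the antiderivatives, vanishing at 0, of the Wronskians in \<open>sform_combination\<close>. At
    \<open>t = 1\<close> they are 1/3, 0 and -1/15, so the endpoint is right if
    \<open>z = - sform w u / 6 - sform u v / 30\<close>; this is the equation that \<open>b\<close>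
    solves.\<close>
  define \<gamma> where "\<gamma> t = p + t *\<^sub>R horiz p w + (t - t^2) *\<^sub>R horiz p u + (t - 3 * t^2 + 2 * t^3) *\<^sub>R horiz p v
     + (t^3 / 3) *\<^sub>R (0, - sform w u / 2) + (t^4 - t^3) *\<^sub>R (0, sform w v / 2)
     + (- 2 * t^3 / 3 + t^4 - 2 * t^5 / 5) *\<^sub>R (0, sform u v / 2)" for t
  define \<gamma>' where "\<gamma>' t = horiz p w + (1 - 2 * t) *\<^sub>R horiz p u + (1 - 6 * t + 6 * t^2) *\<^sub>R horiz p v
     + (t^2) *\<^sub>R (0, - sform w u / 2) + (4 * t^3 - 3 * t^2) *\<^sub>R (0, sform w v / 2)
     + (- 2 * t^2 + 4 * t^3 - 2 * t^4) *\<^sub>R (0, sform u v / 2)" for t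
  have der: "(\<gamma> has_vector_derivative \<gamma>' t) (at t)" for t
    unfolding \<gamma>_def [abs_def] \<gamma>'_def
    by (rule derivative_eq_intros refl | simp)+
  have cont: "continuous_on UNIV \<gamma>'"
    unfolding \<gamma>'_def [abs_def] by (intro continuous_intros)
  have fst_\<gamma>: "fst (\<gamma> t) = fst p + t *\<^sub>R w + (t - t^2) *\<^sub>R u + (t - 3 * t^2 + 2 * t^3) *\<^sub>R v" for t
    by (simp add: \<gamma>_def)
  have fst_\<gamma>': "fst (\<gamma>' t) = w + (1 - 2 * t) *\<^sub>R u + (1 - 6 * t + 6 * t^2) *\<^sub>R v" for t
    by (simp add: \<gamma>'_def)
  have snd_\<gamma>': "snd (\<gamma>' t) = sform (fst p) (fst (\<gamma>' t)) / 2
      + (t^2) *\<^sub>R (- sform w u / 2) + (4 * t^3 - 3 * t^2) *\<^sub>R (sform w v / 2)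
      + (- 2 * t^2 + 4 * t^3 - 2 * t^4) *\<^sub>R (sform u v / 2)" for t
    by (simp add: fst_\<gamma>') (simp add: \<gamma>'_def sform.add_right sform.scaleR_right scaleR_conv_of_real [where 'a = complex] add_divide_distrib)
  have hor: "contact_form (\<gamma> t) (\<gamma>' t) = 0" for t
    unfolding contact_form_def snd_\<gamma>' fst_\<gamma> unfolding fst_\<gamma>' sform_combination
    by (simp add: scaleR_conv_of_real field_simps) (simp add: algebra_simps eval_nat_numeral)
  have "a * a = norm z" "a \<ge> 0" by (simp_all add: a_def)
  have B0: "B \<ge> 0"
    using order_trans[OF norm_ge_zero B[of e e]] ef by simp
  have \<gamma>0: "\<gamma> 0 = p" by (simp add: \<gamma>_def zero_prod_def)
  have \<gamma>1: "\<gamma> 1 = q"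
  proof -
    have "z = - sform w u / 6 - sform u v / 30"
    proof (cases "a = 0")
      case True
      then have "z = 0" by (simp add: a_def)
      with True show ?thesis by (simp add: u_def sform.zero_left sform.zero_right)
    next
      case False
      then show ?thesis
      proof -
        have "sform w u = a * sform w e" "sform u v = a * b"
          by (simp_all add: u_def v_def sform.scaleR_left sform.scaleR_right ef scaleR_conv_of_real [where 'a = complex])
        moreover have "a * b = - 30 * z - 5 * (a * sform w e)"
          using False by (simp add: b_def field_simps)
        ultimately have uv: "sform u v = - 30 * z - 5 * sform w u" by simp
        show ?thesis unfolding uv by (simp add: field_simps)
      qed
    qed
    moreover have "z = snd q - snd p - sform (fst p) w / 2"
      by (simp add: z_def w_def contact_form_def)
    ultimately have "snd q = snd p + sform (fst p) w / 2 - sform w u / 6 - sform u v / 30"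
      by (simp add: algebra_simps)
    then show ?thesis
      by (simp add: \<gamma>_def prod_eq_iff w_def scaleR_conv_of_real [where 'a = complex])
  qed
  have "norm (fst (\<gamma>' t)) \<le> norm w + a + 13 * norm b" if "0 \<le> t" "t \<le> 1" for t
  proof -
    have "t^2 \<le> 1" using that by (simp add: power_le_one)
    then have bd: "\<bar>1 - 2 * t\<bar> \<le> 1" "\<bar>1 - 6 * t + 6 * t^2\<bar> \<le> 13"
      unfolding abs_le_iff using that zero_le_power2[of t] by linarith+
    have "norm u = a" "norm v = norm b"
      using ef by (simp_all add: u_def v_def a_def norm_vec_scale)
    then have "norm ((1 - 2 * t) *\<^sub>R u) \<le> 1 * a" "norm ((1 - 6 * t + 6 * t^2) *\<^sub>R v) \<le> 13 * norm b"
      using mult_right_mono[OF bd(1) \<open>a \<ge> 0\<close>] mult_right_mono[OF bd(2) norm_ge_zero[of b]]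
      by (simp_all only: norm_scaleR)
    then show ?thesis
      unfolding fst_\<gamma>' by (intro norm_triangle_le add_mono) auto
  qed
  from carnot_lengths_curve[OF der cont hor this]
  obtain l where l: "l \<in> carnot_lengths g p q" "l \<le> C * (norm w + a + 13 * norm b)"
    unfolding \<gamma>0 \<gamma>1 by blast
  have "norm b \<le> 30 * a + 5 * B * norm w"
  proof -
    have "norm b \<le> norm (- 30 * z / a) + norm (5 * sform w e)"
      unfolding b_def by (rule norm_triangle_ineq4)
    also have "norm (- 30 * z / a) = 30 * a"
      using \<open>a * a = norm z\<close> by (cases "a = 0") (auto simp: norm_mult norm_divide \<open>a \<ge> 0\<close> field_simps)
    also have "norm (5 * sform w e) \<le> 5 * B * norm w"
      using B[of w e] ef by (simp add: norm_mult)
    finally show ?thesis by simp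
  qed
  \<comment> \<open>391 = 1 + 13 * 30 and 65 = 13 * 5, with 30 and 5 from the formula for
    \<open>b\<close>; 13 = 1 + 6 + 6 is a crude bound for the derivative of the profile of
    \<open>v\<close>.\<close>
  then have "norm w + a + 13 * norm b \<le> (1 + 65 * B) * norm w + 391 * a"
    by (simp add: algebra_simps)
  also have "\<dots> \<le> (391 + 65 * B) * norm w + (391 + 65 * B) * a"
    using B0 by (intro add_mono mult_right_mono) (auto simp: a_def)
  finally have "C * (norm w + a + 13 * norm b) \<le> C * ((391 + 65 * B) * norm w + (391 + 65 * B) * a)"
    using C by (intro mult_left_mono) auto
  with l show ?thesis
    by (intro bexI[of _ l]) (auto simp: w_def a_def z_def algebra_simps)
qed

end

text \<open>A ball-box estimate. The last bound is stated separately because the one before it would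
  need the vertical displacement along a curve to be of second order, while the length only needs
  the first layer speed.\<close>

lemma carnot_dist_bounds:
  fixes g :: "(complex, 'n::finite + 'n) vec \<Rightarrow> (complex, 'n + 'n) vec \<Rightarrow> real"
  assumes "real_inner_product g"
  obtains k K where "0 < k" "0 < K"
    "\<And>p q. k * norm (fst q - fst p) \<le> carnot_dist g p q"
    "\<And>p q. k * sqrt (norm (contact_form p (q - p))) \<le> carnot_dist g p q"
    "\<And>p q. carnot_dist g p q \<le> K * (norm (fst q - fst p) + sqrt (norm (contact_form p (q - p))))"
    "\<And>\<gamma> \<gamma>' M. (\<And>t. (\<gamma> has_vector_derivative \<gamma>' t) (at t)) \<Longrightarrow> continuous_on UNIV \<gamma>' \<Longrightarrow>
       (\<And>t. contact_form (\<gamma> t) (\<gamma>' t) = 0) \<Longrightarrow> (\<And>t. 0 \<le> t \<Longrightarrow> t \<le> 1 \<Longrightarrow> norm (fst (\<gamma>' t)) \<le> M) \<Longrightarrow>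
       carnot_dist g (\<gamma> 0) (\<gamma> 1) \<le> K * M"
proof -
  obtain c C where cC: "0 < c" "0 < C" "\<And>v. c * norm v \<le> sqrt (g v v)" "\<And>v. sqrt (g v v) \<le> C * norm v"
    using real_inner_product_bounds[OF assms] by blast
  interpret carnot_metric g c C
    by unfold_locales (use assms cC in auto)
  obtain B where B0: "B > 0" and "\<And>u v :: (complex, 'n + 'n) vec. norm (sform u v) \<le> norm u * norm v * B"
    using sform.pos_bounded by blast
  then have B: "norm (sform u v) \<le> B * norm u * norm v" for u v :: "(complex, 'n + 'n) vec"
    by (simp add: mult_ac)
  \<comment> \<open>Without a connecting curve the infimum would be that of the empty set.\<close>
  have ne: "carnot_lengths g p q \<noteq> {}" for p q
    using carnot_lengths_upper[OF B] by blast
  have le: "carnot_dist g p q \<le> l" if "l \<in> carnot_lengths g p q" for l p q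
    unfolding carnot_dist_eq_Inf
    by (rule cInf_lower[OF that]) (auto intro!: bdd_belowI[of _ 0] carnot_lengths_lower(1)[OF _ B])
  define k where "k = min c (c / sqrt B)"
  define K where "K = max C (C * (391 + 65 * B))"
  show ?thesis
  proof (rule that[of k K])
    show "k > 0" using cC B0 by (simp add: k_def)
    show "K > 0" using cC B0 by (simp add: K_def)
    fix p q
    show "k * norm (fst q - fst p) \<le> carnot_dist g p q"
      unfolding carnot_dist_eq_Inf
    proof (rule cInf_greatest[OF ne])
      fix l assume "l \<in> carnot_lengths g p q"
      from carnot_lengths_lower(2)[OF this B] have "c * norm (fst q - fst p) \<le> l"
        using cC by (simp add: field_simps)
      moreover have "k * norm (fst q - fst p) \<le> c * norm (fst q - fst p)"
        by (intro mult_right_mono) (auto simp: k_def)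
      ultimately show "k * norm (fst q - fst p) \<le> l" by simp
    qed
    show "k * sqrt (norm (contact_form p (q - p))) \<le> carnot_dist g p q"
      unfolding carnot_dist_eq_Inf
    proof (rule cInf_greatest[OF ne])
      fix l assume l: "l \<in> carnot_lengths g p q"
      have "sqrt (norm (contact_form p (q - p))) \<le> sqrt (B * (l / c)\<^sup>2)"
        by (rule real_sqrt_le_mono[OF carnot_lengths_lower(3)[OF l B]])
      also have "\<dots> = sqrt B * (l / c)"
        using carnot_lengths_lower(1)[OF l B] cC by (simp add: real_sqrt_mult)
      finally have "(c / sqrt B) * sqrt (norm (contact_form p (q - p))) \<le> l"
        using cC B0 by (simp add: field_simps)
      moreover have "k * sqrt (norm (contact_form p (q - p))) \<le> (c / sqrt B) * sqrt (norm (contact_form p (q - p)))"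
        by (intro mult_right_mono) (auto simp: k_def)
      ultimately show "k * sqrt (norm (contact_form p (q - p))) \<le> l" by linarith
    qed
    obtain l where "l \<in> carnot_lengths g p q"
      "l \<le> C * (391 + 65 * B) * (norm (fst q - fst p) + sqrt (norm (contact_form p (q - p))))"
      using carnot_lengths_upper[OF B] by blast
    moreover have "C * (391 + 65 * B) * (norm (fst q - fst p) + sqrt (norm (contact_form p (q - p))))
       \<le> K * (norm (fst q - fst p) + sqrt (norm (contact_form p (q - p))))"
      by (intro mult_right_mono) (auto simp: K_def)
    ultimately show "carnot_dist g p q \<le> K * (norm (fst q - fst p) + sqrt (norm (contact_form p (q - p))))"
      using le by fastforce
  next
    fix \<gamma> \<gamma>' :: "real \<Rightarrow> 'n cheis" and M
    assume *: "\<And>t. (\<gamma> has_vector_derivative \<gamma>' t) (at t)" "continuous_on UNIV \<gamma>'"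
       "\<And>t. contact_form (\<gamma> t) (\<gamma>' t) = 0" and M: "\<And>t. 0 \<le> t \<Longrightarrow> t \<le> 1 \<Longrightarrow> norm (fst (\<gamma>' t)) \<le> M"
    obtain l where "l \<in> carnot_lengths g (\<gamma> 0) (\<gamma> 1)" "l \<le> C * M"
      using carnot_lengths_curve[OF * M] by blast
    moreover have "C * M \<le> K * M"
      using order_trans[OF norm_ge_zero M[of 0]] by (intro mult_right_mono) (auto simp: K_def)
    ultimately show "carnot_dist g (\<gamma> 0) (\<gamma> 1) \<le> K * M"
      using le by fastforce
  qed
qed

section \<open>Contact and distortion from quasiconformality\<close>

text \<open>Multiplies out the extended quotient, so that only a comparison of real distances
  between an inner point \<open>y\<close> and an outer point \<open>y'\<close> is left.\<close>

lemma quasiconformal_eventually: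
  fixes d :: "'a \<Rightarrow> 'a \<Rightarrow> real"
  assumes "quasiconformal d F" and d: "\<And>x y. 0 \<le> d x y"
  obtains H where "0 < H"
    "\<And>x. eventually (\<lambda>r. \<forall>y y'. d x y \<le> r \<longrightarrow> r \<le> d x y' \<longrightarrow> d (F x) (F y) \<le> H * d (F x) (F y')) (at_right 0)"
proof -
  define S where "S x r = (SUP y\<in>{y. d x y \<le> r}. ereal (d (F x) (F y)))" for x r
  define I where "I x r = (INF y\<in>{y. d x y \<ge> r}. ereal (d (F x) (F y)))" for x r
  obtain H0 where H0: "\<And>x. Limsup (at_right 0) (\<lambda>r. S x r / I x r) \<le> ereal H0"
    using assms(1) unfolding quasiconformal_def S_def I_def by blast
  \<comment> \<open>\<open>+ 1\<close> makes the bound on the upper limit strict, so that it holds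
    for all small \<open>r\<close>.\<close>
  define H where "H = max 0 H0 + 1"
  have "H > 0" by (simp add: H_def)
  have "eventually (\<lambda>r. \<forall>y y'. d x y \<le> r \<longrightarrow> r \<le> d x y' \<longrightarrow> d (F x) (F y) \<le> H * d (F x) (F y')) (at_right 0)" for x
  proof -
    have "Limsup (at_right 0) (\<lambda>r. S x r / I x r) < ereal H"
      by (rule le_less_trans[OF H0]) (simp add: H_def)
    from Limsup_lessD[OF this] show ?thesis
    proof (rule eventually_mono, intro allI impI)
      fix r y y'
      assume elim: "S x r / I x r < ereal H" "d x y \<le> r" "r \<le> d x y'"
      have S: "ereal (d (F x) (F y)) \<le> S x r"
        unfolding S_def using elim by (intro SUP_upper) auto
      have I: "I x r \<le> ereal (d (F x) (F y'))"
        unfolding I_def using elim by (intro INF_lower) auto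
      have I0: "0 \<le> I x r"
        unfolding I_def by (intro INF_greatest) (simp add: d)
      obtain i where i: "I x r = ereal i" "0 \<le> i"
        using I I0 by (cases "I x r") auto
      have S0: "0 \<le> S x r"
        using S d[of "F x" "F y"] by (smt (verit) ereal_less_eq(5) order_trans)
      \<comment> \<open>If \<open>i = 0\<close>, the quotient is finite only when
        \<open>S x r = 0\<close>.\<close>
      have "S x r \<le> ereal (H * i)"
      proof (cases "S x r")
        case (real s)
        with elim(1) i S0 show ?thesis
          by (cases "i = 0"; cases "s = 0") (auto simp: divide_ereal_def field_simps)
      next
        case PInf
        with elim(1) i show ?thesis by (cases "i = 0") (auto simp: divide_ereal_def)
      qed (use S0 in auto)
      with S have "d (F x) (F y) \<le> H * i"
        by (metis ereal_less_eq(3) order_trans)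
      also have "\<dots> \<le> H * d (F x) (F y')"
        using I i \<open>H > 0\<close> by simp
      finally show "d (F x) (F y) \<le> H * d (F x) (F y')" .
    qed
  qed
  with \<open>H > 0\<close> show ?thesis by (rule that)
qed

lemma norm_fst_le_norm: "norm (fst x) \<le> norm x"
  by (metis norm_fst_le prod.collapse)

lemma eventually_at_right_scale:
  fixes R :: real
  assumes "eventually P (at_right 0)" "R > 0"
  shows "eventually (\<lambda>t. P (R * t)) (at_right 0)"
proof -
  obtain b where "b > 0" "\<And>y. y > 0 \<Longrightarrow> y < b \<Longrightarrow> P y"
    using assms(1) by (auto simp: eventually_at_right_field)
  then show ?thesis
    using \<open>R > 0\<close> by (auto simp: eventually_at_right_field field_simps intro!: exI[of _ "b / R"])
qed

locale carnot_distance =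
  fixes d :: "'n::finite cheis \<Rightarrow> 'n cheis \<Rightarrow> real" and k K :: real
  assumes k: "0 < k" and K: "0 < K"
    and dist_fst: "\<And>p q. k * norm (fst q - fst p) \<le> d p q"
    and dist_contact: "\<And>p q. k * sqrt (norm (contact_form p (q - p))) \<le> d p q"
    and dist_upper: "\<And>p q. d p q \<le> K * (norm (fst q - fst p) + sqrt (norm (contact_form p (q - p))))"
    and dist_curve: "\<And>\<gamma> \<gamma>' M. (\<And>t. (\<gamma> has_vector_derivative \<gamma>' t) (at t)) \<Longrightarrow> continuous_on UNIV \<gamma>' \<Longrightarrow>
       (\<And>t. contact_form (\<gamma> t) (\<gamma>' t) = 0) \<Longrightarrow> (\<And>t. 0 \<le> t \<Longrightarrow> t \<le> 1 \<Longrightarrow> norm (fst (\<gamma>' t)) \<le> M) \<Longrightarrow>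
       d (\<gamma> 0) (\<gamma> 1) \<le> K * M"
begin

lemma dist_nonneg: "0 \<le> d p q"
  using dist_fst[of q p] k by (smt (verit) mult_nonneg_nonneg norm_ge_zero)

text \<open>If the image of a horizontal displacement of size t had a vertical part of order t, its
  distance would be of order sqrt t at least. A vertical displacement of Euclidean size of order
  t^2, at least as far from \<open>x\<close>, has its image within distance of order t, because
  \<open>F\<close> is Lipschitz at \<open>x\<close>. Quasiconformality then bounds sqrt t by a
  multiple of t.\<close>

lemma quasiconformal_contact:
  assumes dF: "(F has_derivative F') (at x)"
    and qc: "eventually (\<lambda>r. \<forall>y y'. d x y \<le> r \<longrightarrow> r \<le> d x y' \<longrightarrow> d (F x) (F y) \<le> H * d (F x) (F y')) (at_right 0)"
    and "0 < H"
  shows "contact_form (F x) (F' (horiz x u)) = 0"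
proof (rule ccontr)
  define a where "a = horiz x u"
  define \<theta> where "\<theta> = contact_form (F x)"
  define \<kappa> where "\<kappa> = \<theta> (F' a)"
  assume "contact_form (F x) (F' (horiz x u)) \<noteq> 0"
  then have \<kappa>: "norm \<kappa> > 0" by (simp add: \<kappa>_def \<theta>_def a_def)
  have "bounded_linear \<theta>"
    unfolding \<theta>_def using linear_contact_form by (simp add: linear_conv_bounded_linear)
  then interpret \<theta>: bounded_linear \<theta> .
  interpret F': bounded_linear F'
    using dF by (rule has_derivative_bounded_linear)
  obtain N where N: "N > 0" "\<And>v. norm (\<theta> v) \<le> norm v * N"
    using \<theta>.pos_bounded by blast
  obtain N' where N': "N' > 0" "\<And>v. norm (F' v) \<le> norm v * N'"
    using F'.pos_bounded by blast
  \<comment> \<open>Makes the remainder at most half of the supposed vertical part of the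
    image.\<close>
  define e where "e = norm \<kappa> / (2 * N * (norm a + 1))"
  have na: "norm a + 1 > 0" by (simp add: add_nonneg_pos)
  have "e > 0" using \<kappa> N na by (simp add: e_def)
  then obtain \<delta> where "\<delta> > 0" and \<delta>: "\<And>y. norm (y - x) < \<delta> \<Longrightarrow> norm (F y - F x - F' (y - x)) \<le> e * norm (y - x)"
    using dF unfolding has_derivative_at_alt by blast
  define M where "M = N' + e"
  have "M > 0" using N' \<open>e > 0\<close> by (simp add: M_def)
  have M: "norm (F y - F x) \<le> M * norm (y - x)" if "norm (y - x) < \<delta>" for y
    using norm_triangle_sub[of "F y - F x" "F' (y - x)"] \<delta>[OF that] N'(2)[of "y - x"]
    by (simp add: M_def algebra_simps)
  \<comment> \<open>Chosen to give \<open>d x y \<le> R * t\<close>; the \<open>+ 1\<close> keeps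
    \<open>R\<close> positive when \<open>u = 0\<close>.\<close>
  define R where "R = K * (norm u + 1)"
  have "R > 0" using K by (simp add: R_def add_nonneg_pos)
  define Q where "Q = H * K * (M * (R / k)\<^sup>2 + sqrt (N * M) * (R / k))"
  have ev1: "eventually (\<lambda>t. t * norm a < \<delta>) (at_right 0)"
  proof (rule order_tendstoD)
    show "((\<lambda>t. t * norm a) \<longlongrightarrow> 0) (at_right 0)"
      by (auto intro!: tendsto_eq_intros)
  qed fact
  have ev2: "eventually (\<lambda>t. (R * t / k)\<^sup>2 < \<delta>) (at_right 0)"
  proof (rule order_tendstoD)
    show "((\<lambda>t. (R * t / k)\<^sup>2) \<longlongrightarrow> 0) (at_right 0)"
      using k by (auto intro!: tendsto_eq_intros)
  qed fact
  have ev3: "eventually (\<lambda>t. 0 < t \<and> t < (1::real)) (at_right 0)"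
    by (auto simp: eventually_at_right_field intro!: exI[of _ 1])
  have "eventually (\<lambda>t. k * sqrt (norm \<kappa> / 2) \<le> Q * sqrt t) (at_right 0)"
    using ev1 ev2 ev3 eventually_at_right_scale[OF qc \<open>R > 0\<close>]
  proof eventually_elim
    case (elim t)
    define y where "y = x + t *\<^sub>R a"
    \<comment> \<open>The size for which \<open>dist_contact\<close> places \<open>y'\<close> at
      distance at least \<open>R * t\<close>.\<close>
    define s where "s = complex_of_real ((R * t / k)\<^sup>2)"
    define y' where "y' = x + (0, s)"
    have norm_s: "norm s = (R * t / k)\<^sup>2"
      by (simp add: s_def flip: of_real_power)
    have "d x y \<le> K * (norm (t *\<^sub>R u) + sqrt (norm (contact_form x (t *\<^sub>R a))))"
      using dist_upper[of x y] by (simp add: y_def a_def)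
    also have "contact_form x (t *\<^sub>R a) = 0"
      by (simp add: a_def linear_scale[OF linear_contact_form])
    also have "K * (norm (t *\<^sub>R u) + sqrt (norm (0::complex))) \<le> R * t"
      using K elim by (simp add: R_def algebra_simps)
    finally have dy: "d x y \<le> R * t" .
    have "k * sqrt (norm s) \<le> d x y'"
      using dist_contact[of x y'] by (simp add: y'_def contact_form_def sform.zero_right)
    then have dy': "R * t \<le> d x y'"
      using k elim \<open>R > 0\<close> by (simp add: norm_s)
    have "norm (y - x) < \<delta>" using elim by (simp add: y_def)
    have "norm (\<theta> (F y - F x) - t *\<^sub>R \<kappa>) = norm (\<theta> (F y - F x - F' (y - x)))"
      by (simp add: \<theta>.diff \<kappa>_def y_def F'.scaleR \<theta>.scaleR)
    also have "\<dots> \<le> norm (F y - F x - F' (y - x)) * N" by (rule N)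
    also have "\<dots> \<le> (e * norm (y - x)) * N"
      using N \<delta>[OF \<open>norm (y - x) < \<delta>\<close>] by (intro mult_right_mono) auto
    also have "\<dots> = t * (norm \<kappa> / 2) * (norm a / (norm a + 1))"
      using elim N by (simp add: y_def e_def)
    also have "\<dots> \<le> t * (norm \<kappa> / 2) * 1"
      using elim na by (intro mult_left_mono) (auto simp: divide_le_eq_1_pos)
    finally have "t * (norm \<kappa> / 2) \<le> norm (\<theta> (F y - F x))"
      using norm_triangle_ineq3[of "\<theta> (F y - F x)" "t *\<^sub>R \<kappa>"] elim by simp
    then have "sqrt (t * (norm \<kappa> / 2)) \<le> sqrt (norm (\<theta> (F y - F x)))"
      by (rule real_sqrt_le_mono)
    then have "k * (sqrt t * sqrt (norm \<kappa> / 2)) \<le> k * sqrt (norm (\<theta> (F y - F x)))"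
      using k unfolding real_sqrt_mult by (intro mult_left_mono) auto
    also have "\<dots> \<le> d (F x) (F y)"
      unfolding \<theta>_def by (rule dist_contact)
    also have "\<dots> \<le> H * d (F x) (F y')"
      using elim dy dy' by blast
    finally have 1: "k * (sqrt t * sqrt (norm \<kappa> / 2)) \<le> H * d (F x) (F y')" .
    have M': "norm (F y' - F x) \<le> M * norm s"
      using M[of y'] elim norm_s by (simp add: y'_def)
    have "norm (fst (F y') - fst (F x)) \<le> M * norm s"
      using M' norm_fst_le_norm[of "F y' - F x"] by simp
    moreover have "norm (\<theta> (F y' - F x)) \<le> (N * M) * norm s"
      using order_trans[OF N(2) mult_right_mono[OF M', of N]] N(1) by (simp add: mult_ac)
    then have "sqrt (norm (\<theta> (F y' - F x))) \<le> sqrt ((N * M) * norm s)"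
      by (rule real_sqrt_le_mono)
    ultimately have "d (F x) (F y') \<le> K * (M * norm s + sqrt ((N * M) * norm s))"
      using K by (intro order_trans[OF dist_upper] mult_left_mono add_mono) (auto simp: \<theta>_def)
    also have "\<dots> = K * (M * (R / k)\<^sup>2 * (t * t) + sqrt (N * M) * (R / k) * t)"
    proof -
      have "sqrt ((N * M) * norm s) = sqrt (N * M) * (R * t / k)"
        unfolding real_sqrt_mult [of "N * M"] norm_s using elim k \<open>R > 0\<close> by simp
      then show ?thesis by (simp add: norm_s power2_eq_square mult_ac)
    qed
    also have "\<dots> \<le> K * (M * (R / k)\<^sup>2 * t + sqrt (N * M) * (R / k) * t)"
      using elim K \<open>M > 0\<close> by (intro mult_left_mono add_mono order_refl) auto
    finally have "H * d (F x) (F y') \<le> H * \<dots>"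
      using \<open>0 < H\<close> by (intro mult_left_mono) auto
    also have "\<dots> = Q * t"
      by (simp add: Q_def algebra_simps)
    finally have "H * d (F x) (F y') \<le> Q * t" .
    with 1 have "k * (sqrt t * sqrt (norm \<kappa> / 2)) \<le> Q * (sqrt t * sqrt t)"
      using elim by simp
    then have "sqrt t * (k * sqrt (norm \<kappa> / 2)) \<le> sqrt t * (Q * sqrt t)"
      by (simp add: mult_ac)
    then show ?case
      using elim by (simp only: mult_le_cancel_left_pos real_sqrt_gt_zero)
  qed
  moreover have "((\<lambda>t. Q * sqrt t) \<longlongrightarrow> 0) (at_right 0)"
    by (auto intro!: tendsto_eq_intros)
  ultimately have "k * sqrt (norm \<kappa> / 2) \<le> 0"
    by (intro tendsto_lowerbound) auto
  then show False using k \<kappa> by (simp add: mult_le_0_iff)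
qed

text \<open>Both test points lie on horizontal lines through \<open>x\<close>. The image of the
  inner one is bounded below by its first layer displacement. For the outer one, the image of the
  whole segment is a horizontal curve by \<open>contact\<close>, and its length gives an upper bound
  without a square root term.\<close>

lemma quasiconformal_distortion:
  assumes dF: "\<And>q. (F has_derivative F' q) (at q)"
    and cont: "\<And>a. continuous_on UNIV (\<lambda>q. F' q a)"
    and contact: "\<And>q v. contact_form (F q) (F' q (horiz q v)) = 0"
    and qc: "eventually (\<lambda>r. \<forall>y y'. d x y \<le> r \<longrightarrow> r \<le> d x y' \<longrightarrow> d (F x) (F y) \<le> H * d (F x) (F y')) (at_right 0)"
    and "0 < H"
  shows "norm (fst (F' x (horiz x u))) * norm v \<le> H * K\<^sup>2 / k\<^sup>2 * norm (fst (F' x (horiz x v))) * norm u"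
proof (cases "u = 0 \<or> v = 0")
  case True
  have "F' x (horiz x 0) = 0"
    using dF[of x] by (simp add: has_derivative_bounded_linear linear_simps linear_0[OF linear_horiz])
  with True show ?thesis by auto
next
  case False
  define a where "a = horiz x u"
  define b where "b = horiz x v"
  \<comment> \<open>The stretch that makes \<open>d x y \<le> R * t \<le> d x y'\<close>. It
    contributes one factor K / k to the final constant; the other comes from the lower bound with
    \<open>k\<close> and the length bound with \<open>K\<close>.\<close>
  define \<rho> where "\<rho> = K * norm u / (k * norm v)"
  define R where "R = K * norm u"
  have "\<rho> > 0" "R > 0" using K k False by (simp_all add: \<rho>_def R_def)
  have lin: "F' q (c *\<^sub>R w) = c *\<^sub>R F' q w" for q c w
    using dF[of q] by (simp add: has_derivative_bounded_linear linear_simps)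
  have approx: "k * (norm (fst (F' x a)) - \<epsilon>) \<le> H * K * \<rho> * (norm (fst (F' x b)) + \<epsilon>)" if \<epsilon>: "\<epsilon> > 0" for \<epsilon>
  proof -
    define e where "e = \<epsilon> / (norm a + 1)"
    have na: "norm a + 1 > 0" by (simp add: add_nonneg_pos)
    have "e > 0" using that na by (simp add: e_def)
    then obtain \<delta> where "\<delta> > 0" and \<delta>: "\<And>y. norm (y - x) < \<delta> \<Longrightarrow> norm (F y - F x - F' x (y - x)) \<le> e * norm (y - x)"
      using dF[of x] unfolding has_derivative_at_alt by blast
    have "isCont (\<lambda>q. F' q b) x"
      using cont [of b] by (simp only: continuous_on_eq_continuous_at [OF open_UNIV] UNIV_I ball_UNIV)
    then obtain \<eta> where "\<eta> > 0" and \<eta>: "\<And>q. norm (q - x) < \<eta> \<Longrightarrow> norm (F' q b - F' x b) < \<epsilon>"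
      using \<epsilon> unfolding continuous_at_eps_delta dist_norm by blast
    have "eventually (\<lambda>t. t * norm a < \<delta>) (at_right 0)"
    proof (rule order_tendstoD)
      show "((\<lambda>t. t * norm a) \<longlongrightarrow> 0) (at_right 0)"
        by (auto intro!: tendsto_eq_intros)
    qed fact
    moreover have "eventually (\<lambda>t. t * (\<rho> * norm b) < \<eta>) (at_right 0)"
    proof (rule order_tendstoD)
      show "((\<lambda>t. t * (\<rho> * norm b)) \<longlongrightarrow> 0) (at_right 0)"
        by (auto intro!: tendsto_eq_intros)
    qed fact
    moreover have "eventually (\<lambda>t. 0 < (t::real)) (at_right 0)"
      by (simp add: eventually_at_right_less)
    ultimately
    have "eventually (\<lambda>t. k * (norm (fst (F' x a)) - \<epsilon>) \<le> H * K * \<rho> * (norm (fst (F' x b)) + \<epsilon>)) (at_right (0::real))"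
      using eventually_at_right_scale[OF qc \<open>R > 0\<close>]
    proof eventually_elim
      case (elim t)
      define y where "y = x + t *\<^sub>R a"
      define y' where "y' = x + (t * \<rho>) *\<^sub>R b"
      have "d x y \<le> K * (norm (t *\<^sub>R u) + sqrt (norm (contact_form x (t *\<^sub>R a))))"
        using dist_upper[of x y] by (simp add: y_def a_def)
      also have "contact_form x (t *\<^sub>R a) = 0"
        by (simp add: a_def linear_scale[OF linear_contact_form])
      also have "K * (norm (t *\<^sub>R u) + sqrt (norm (0::complex))) = R * t"
        using elim by (simp add: R_def)
      finally have dy: "d x y \<le> R * t" .
      have "k * norm ((t * \<rho>) *\<^sub>R v) \<le> d x y'"
        using dist_fst[of y' x] by (simp add: y'_def b_def)
      moreover have "k * norm ((t * \<rho>) *\<^sub>R v) = R * t"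
        using elim \<open>\<rho> > 0\<close> k False by (simp add: abs_mult R_def) (simp add: \<rho>_def)
      ultimately have dy': "R * t \<le> d x y'" by simp
      have "d (F (x + (0 * (t * \<rho>)) *\<^sub>R b)) (F (x + (1 * (t * \<rho>)) *\<^sub>R b)) \<le> K * (t * \<rho> * (norm (fst (F' x b)) + \<epsilon>))"
      proof (rule dist_curve[of "\<lambda>\<tau>. F (x + (\<tau> * (t * \<rho>)) *\<^sub>R b)" "\<lambda>\<tau>. (t * \<rho>) *\<^sub>R F' (x + (\<tau> * (t * \<rho>)) *\<^sub>R b) b"])
        fix \<tau> :: real
        have "((\<lambda>\<tau>. F (x + (\<tau> * (t * \<rho>)) *\<^sub>R b)) has_derivative
            (\<lambda>h. F' (x + (\<tau> * (t * \<rho>)) *\<^sub>R b) ((h * (t * \<rho>)) *\<^sub>R b))) (at \<tau>)"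
          by (rule has_derivative_compose[OF _ dF]) (auto intro!: derivative_eq_intros)
        then show "((\<lambda>\<tau>. F (x + (\<tau> * (t * \<rho>)) *\<^sub>R b)) has_vector_derivative
            (t * \<rho>) *\<^sub>R F' (x + (\<tau> * (t * \<rho>)) *\<^sub>R b) b) (at \<tau>)"
          by (simp add: has_vector_derivative_def lin)
        have "b = horiz (x + (\<tau> * (t * \<rho>)) *\<^sub>R b) v"
          by (simp add: b_def)
        then show "contact_form (F (x + (\<tau> * (t * \<rho>)) *\<^sub>R b)) ((t * \<rho>) *\<^sub>R F' (x + (\<tau> * (t * \<rho>)) *\<^sub>R b) b) = 0"
          using contact[of "x + (\<tau> * (t * \<rho>)) *\<^sub>R b" v] by (simp add: linear_scale[OF linear_contact_form])
      next
        fix \<tau> :: real assume \<tau>: "0 \<le> \<tau>" "\<tau> \<le> 1"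
        have "norm ((\<tau> * (t * \<rho>)) *\<^sub>R b) \<le> t * (\<rho> * norm b)"
          using \<tau> elim \<open>\<rho> > 0\<close> mult_right_mono[of \<tau> 1 "t * (\<rho> * norm b)"] by (simp add: abs_mult mult_ac)
        then have "norm (F' (x + (\<tau> * (t * \<rho>)) *\<^sub>R b) b - F' x b) < \<epsilon>"
          using elim by (intro \<eta>) simp
        then have "norm (fst (F' (x + (\<tau> * (t * \<rho>)) *\<^sub>R b) b) - fst (F' x b)) < \<epsilon>"
          using norm_fst_le_norm[of "F' (x + (\<tau> * (t * \<rho>)) *\<^sub>R b) b - F' x b"] by simp
        then have "norm (fst (F' (x + (\<tau> * (t * \<rho>)) *\<^sub>R b) b)) \<le> norm (fst (F' x b)) + \<epsilon>"
          using norm_triangle_sub[of "fst (F' (x + (\<tau> * (t * \<rho>)) *\<^sub>R b) b)" "fst (F' x b)"] by linarith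
        then show "norm (fst ((t * \<rho>) *\<^sub>R F' (x + (\<tau> * (t * \<rho>)) *\<^sub>R b) b)) \<le> t * \<rho> * (norm (fst (F' x b)) + \<epsilon>)"
          using elim \<open>\<rho> > 0\<close> by (simp add: abs_mult mult_left_mono)
      next
        show "continuous_on UNIV (\<lambda>\<tau>. (t * \<rho>) *\<^sub>R F' (x + (\<tau> * (t * \<rho>)) *\<^sub>R b) b)"
          by (intro continuous_on_scaleR continuous_on_const continuous_on_compose2[OF cont]) (auto intro!: continuous_intros)
      qed
      then have up: "d (F x) (F y') \<le> K * (t * \<rho> * (norm (fst (F' x b)) + \<epsilon>))"
        by (simp add: y'_def)
      have "norm (y - x) < \<delta>" using elim by (simp add: y_def)
      have "norm (fst (F y) - fst (F x) - t *\<^sub>R fst (F' x a)) \<le> norm (F y - F x - F' x (y - x))"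
        using norm_fst_le_norm[of "F y - F x - F' x (y - x)"] by (simp add: y_def lin)
      also have "\<dots> \<le> e * norm (y - x)"
        by (rule \<delta>) fact
      also have "\<dots> = t * \<epsilon> * (norm a / (norm a + 1))"
        using elim by (simp add: y_def e_def)
      also have "\<dots> \<le> t * \<epsilon> * 1"
        using elim \<epsilon> na by (intro mult_left_mono) (auto simp: divide_le_eq_1_pos)
      finally have "t * (norm (fst (F' x a)) - \<epsilon>) \<le> norm (fst (F y) - fst (F x))"
        using norm_triangle_ineq3[of "fst (F y) - fst (F x)" "t *\<^sub>R fst (F' x a)"] elim
        by (simp add: algebra_simps)
      then have "k * (t * (norm (fst (F' x a)) - \<epsilon>)) \<le> k * norm (fst (F y) - fst (F x))"
        using k by simp
      also have "\<dots> \<le> d (F x) (F y)"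
        by (rule dist_fst)
      also have "\<dots> \<le> H * d (F x) (F y')"
        using elim dy dy' by blast
      also have "\<dots> \<le> H * (K * (t * \<rho> * (norm (fst (F' x b)) + \<epsilon>)))"
        using up \<open>H > 0\<close> by simp
      finally have "t * (k * (norm (fst (F' x a)) - \<epsilon>)) \<le> t * (H * K * \<rho> * (norm (fst (F' x b)) + \<epsilon>))"
        by (simp add: mult_ac)
      then show ?case
        using elim by (simp only: mult_le_cancel_left_pos)
    qed
    then show ?thesis
      by (simp add: eventually_const_iff)
  qed
  have "k * norm (fst (F' x a)) \<le> H * K * \<rho> * norm (fst (F' x b)) + e" if "e > 0" for e
  proof -
    have pos: "k + H * K * \<rho> > 0" using k K \<open>H > 0\<close> \<open>\<rho> > 0\<close> by (simp add: add_pos_pos)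
    define \<epsilon> where "\<epsilon> = e / (k + H * K * \<rho>)"
    have "\<epsilon> > 0" using that pos by (simp add: \<epsilon>_def)
    from approx[OF this] have "k * norm (fst (F' x a)) \<le> H * K * \<rho> * norm (fst (F' x b)) + (k + H * K * \<rho>) * \<epsilon>"
      by (simp add: algebra_simps)
    then show ?thesis using pos by (simp add: \<epsilon>_def)
  qed
  then have "k * norm (fst (F' x a)) \<le> H * K * \<rho> * norm (fst (F' x b))"
    by (rule field_le_epsilon)
  then show ?thesis
    using k False by (simp add: \<rho>_def a_def b_def field_simps power2_eq_square)
qed

end

section \<open>Contact maps of class C2\<close>

lemma heis_scale_simps:
  "fst (heis_scale c a) = c *s fst a" "snd (heis_scale c a) = c * snd a"
  by (simp_all add: heis_scale_def)

lemma bounded_linear_heis_scale: "bounded_linear (\<lambda>c. heis_scale c a)"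
proof -
  have "linear (\<lambda>c. heis_scale c a)"
    by (rule linearI) (auto simp: heis_scale_def prod_eq_iff vec_eq_iff ring_distribs)
  then show ?thesis by (simp add: linear_conv_bounded_linear)
qed

lemma vec_scale_eq_scaleR: "c *s (v :: (complex, 'i::finite) vec) = Re c *\<^sub>R v + Im c *\<^sub>R (\<i> *s v)"
  by (simp add: vec_eq_iff complex_eq_iff)

lemma heis_scale_eq_scaleR: "heis_scale c a = Re c *\<^sub>R a + Im c *\<^sub>R heis_scale \<i> a"
  by (simp add: prod_eq_iff heis_scale_simps vec_scale_eq_scaleR[symmetric] complex_eq_iff)

lemma horiz_fst_scale [simp]: "horiz (q + heis_scale c (horiz q v)) v = horiz q v"
  by (simp add: horiz_def heis_scale_def sform.add_left)

text \<open>\<open>s\<close> is a parameter because the domain carries \<open>*s\<close> in one use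
  and \<open>heis_scale\<close> in the other.\<close>

lemma complex_linear_vecI:
  fixes A :: "'a::real_vector \<Rightarrow> (complex, 'j::finite) vec"
  assumes "linear A" "\<And>u. A (s \<i> u) = \<i> *s A u" "\<And>c u. s c u = Re c *\<^sub>R u + Im c *\<^sub>R s \<i> u"
  shows "A (s c u) = c *s A u"
proof -
  have "A (s c u) = Re c *\<^sub>R A u + Im c *\<^sub>R A (s \<i> u)"
    by (subst assms(3)) (simp add: linear_add[OF assms(1)] linear_scale[OF assms(1)])
  then show ?thesis
    by (simp add: assms(2) vec_scale_eq_scaleR[of c "A u"])
qed

text \<open>The link to one-variable theory: a real derivative that is complex linear along a line
  is a complex derivative there.\<close>

lemma has_field_derivative_heis_line:
  assumes "(\<phi> has_derivative \<phi>') (at (p + heis_scale \<tau> a))"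
    and "\<And>c. \<phi>' (heis_scale c a) = c * \<phi>' a"
  shows "((\<lambda>\<tau>. \<phi> (p + heis_scale \<tau> a)) has_field_derivative \<phi>' a) (at \<tau>)"
proof -
  have "((\<lambda>\<tau>. p + heis_scale \<tau> a) has_derivative (\<lambda>h. heis_scale h a)) (at \<tau>)"
    using has_derivative_add[OF has_derivative_const bounded_linear_imp_has_derivative[OF bounded_linear_heis_scale]]
    by simp
  from has_derivative_compose[OF this assms(1)] show ?thesis
    by (simp add: has_field_derivative_def assms(2) mult.commute[of _ "\<phi>' a"])
qed

text \<open>\<open>T = L^-1 i L\<close> is the complex structure of the target seen through
  \<open>L\<close>. Moving i between the arguments of \<open>sform\<close>, in source and target,
  shows that \<open>T\<close> commutes with multiplication by i, so \<open>T\<close> is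
  multiplication by some t with t^2 = -1. Hence \<open>L\<close> is linear or conjugate linear, and
  nondegeneracy of \<open>sform\<close> transfers this to \<open>A\<close>.\<close>

lemma symplectic_similitude_cases:
  fixes A :: "(complex, 'n::finite + 'n) vec \<Rightarrow> (complex, 'n + 'n) vec"
  assumes A: "linear A" "inj A" and L: "linear L"
    and AL: "\<And>u v. sform (A u) (A v) = L (sform u v)"
  shows "(\<forall>u. A (\<i> *s u) = \<i> *s A u) \<or> (\<forall>u. A (\<i> *s u) = (- \<i>) *s A u)"
proof -
  have surjA: "surj A"
    using linear_injective_imp_surjective[OF A] by simp
  define e :: "(complex, 'n + 'n) vec" where "e = axis (Inl undefined) 1"
  define f :: "(complex, 'n + 'n) vec" where "f = axis (Inr undefined) 1"
  have "sform e f = 1"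
    unfolding e_def f_def by simp
  then have ef: "sform e (s *s f) = s" for s
    by (simp only: sform_scale_right mult_1_right)
  have surjL: "surj L"
  proof (rule surjI)
    fix s
    show "L (sform (inv A e) (inv A (s *s f))) = s"
      by (simp only: AL[symmetric] surj_f_inv_f[OF surjA] ef)
  qed
  then have injL: "inj L"
    using linear_surjective_imp_injective[OF L] by simp
  define T where "T s = inv L (\<i> * L s)" for s
  have LT: "L (T s) = \<i> * L s" for s
    by (simp add: T_def surj_f_inv_f[OF surjL])
  have T_add: "T (s + s') = T s + T s'" for s s'
    by (rule injD[OF injL]) (simp add: LT linear_add[OF L] ring_distribs)
  have T_scale: "T (r *\<^sub>R s) = r *\<^sub>R T s" for r s
    by (rule injD[OF injL]) (simp add: LT linear_scale[OF L])
  \<comment> \<open>The source factor i is put on \<open>e\<close> and the target factor i on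
    \<open>A v\<close>; as they sit in different arguments, they can be pulled out in either
    order.\<close>
  have T_i: "T (\<i> * s) = \<i> * T s" for s
  proof (rule injD[OF injL])
    define v where "v = s *s f"
    define v' where "v' = inv A (\<i> *s A v)"
    have v': "A v' = \<i> *s A v"
      by (simp add: v'_def surj_f_inv_f[OF surjA])
    have "L (sform e v') = L (T s)"
      by (simp only: AL[symmetric] v' LT sform_scale_right) (simp only: AL v_def ef)
    then have "sform e v' = T s"
      by (rule injD[OF injL])
    then have "L (\<i> * T s) = L (sform (\<i> *s e) v')" by simp
    also have "\<dots> = \<i> * L (sform (\<i> *s e) v)"
      by (simp only: AL[symmetric] v' sform_scale_right)
    also have "\<dots> = L (T (\<i> * s))"
      by (simp only: LT v_def ef sform_scale_left)
    finally show "L (T (\<i> * s)) = L (\<i> * T s)" ..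
  qed
  define t where "t = T 1"
  have T: "T s = t * s" for s
  proof -
    have "s = Re s *\<^sub>R 1 + Im s *\<^sub>R (\<i> * 1)" by (simp add: complex_eq_iff)
    then have "T s = Re s *\<^sub>R t + Im s *\<^sub>R (\<i> * t)"
      by (metis T_add T_scale T_i t_def)
    then show ?thesis by (simp add: complex_eq_iff algebra_simps)
  qed
  have "t * t = -1"
  proof (rule injD[OF injL])
    have "L (t * t) = L (T (T 1))" by (simp add: T)
    then show "L (t * t) = L (-1)" by (simp only: LT linear_neg[OF L]) simp
  qed
  then have "(t - \<i>) * (t + \<i>) = 0" by (simp add: algebra_simps)
  then have "t = \<i> \<or> t = - \<i>" by (auto simp: eq_neg_iff_add_eq_0)
  moreover have "A (\<i> *s u) = k *s A u" if k: "\<And>s. L (\<i> * s) = k * L s" for k u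
  proof -
    have "sform (A (\<i> *s u) - k *s A u) (A v) = 0" for v
      by (simp add: sform.diff_left AL k)
    then have "sform (A (\<i> *s u) - k *s A u) w = 0" for w
      by (metis surjA surj_f_inv_f)
    then show ?thesis
      by (metis eq_iff_diff_eq_0 norm_eq_zero of_real_eq_0_iff power_eq_0_iff sform_dual)
  qed
  moreover have "L (\<i> * s) = \<i> * L s" if "t = \<i>" for s
    using LT[of s] by (simp add: T that)
  moreover have "L (\<i> * s) = (- \<i>) * L s" if "t = - \<i>" for s
    using LT[of s] by (simp add: T that linear_neg[OF L]) (metis minus_minus)
  ultimately show ?thesis by metis
qed

locale contact_C2 =
  fixes F :: "'n::finite cheis \<Rightarrow> 'n cheis"
    and F' :: "'n cheis \<Rightarrow> 'n cheis \<Rightarrow> 'n cheis"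
    and F'' :: "'n cheis \<Rightarrow> 'n cheis \<Rightarrow> 'n cheis \<Rightarrow> 'n cheis"
  assumes dF: "\<And>q. (F has_derivative F' q) (at q)"
    and dF': "\<And>q v. ((\<lambda>q. F' q v) has_derivative (\<lambda>h. F'' q h v)) (at q)"
    and contact: "\<And>q v. contact_form (F q) (F' q (horiz q v)) = 0"
    and immersive: "\<And>q v. fst (F' q (horiz q v)) = 0 \<Longrightarrow> v = 0"
begin

text \<open>In left invariant frames the differential of a contact map is block triangular;
  \<open>A\<close> and \<open>\<Lambda>\<close> are the diagonal blocks, acting on the first and the
  second layer.\<close>

definition A where "A q v = fst (F' q (horiz q v))"

definition \<Lambda> where "\<Lambda> q s = contact_form (F q) (F' q (0, s))"

lemma linear_F': "linear (F' q)"
  using has_derivative_bounded_linear[OF dF] by (rule bounded_linear.linear)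

lemma F''_sym: "F'' q a b = F'' q b a"
  by (rule second_derivative_symmetric[OF dF dF'])

lemma linear_F'': "linear (F'' q a)"
  using has_derivative_bounded_linear[OF dF'[of a q]] by (simp add: F''_sym[of q _ a] bounded_linear.linear)

text \<open>\<open>dF'\<close> differentiates \<open>F'\<close> in one fixed direction at a time;
  expansion in a basis replaces the moving direction \<open>a q\<close> by finitely many fixed
  ones.\<close>

lemma has_derivative_F'_apply:
  assumes a: "(a has_derivative a') (at q)"
  shows "((\<lambda>q. F' q (a q)) has_derivative (\<lambda>h. F'' q h (a q) + F' q (a' h))) (at q)"
proof -
  have F'_basis: "F' q x = (\<Sum>b\<in>Basis. (x \<bullet> b) *\<^sub>R F' q b)" for q x
    by (subst (1) euclidean_representation[of x, symmetric])
       (simp only: linear_sum[OF linear_F'] linear_scale[OF linear_F'])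
  have F''_basis: "F'' q h x = (\<Sum>b\<in>Basis. (x \<bullet> b) *\<^sub>R F'' q h b)" for q h x
    by (subst (1) euclidean_representation[of x, symmetric])
       (simp only: linear_sum[OF linear_F''] linear_scale[OF linear_F''])
  have "((\<lambda>q. \<Sum>b\<in>Basis. (a q \<bullet> b) *\<^sub>R F' q b) has_derivative
      (\<lambda>h. \<Sum>b\<in>Basis. (a q \<bullet> b) *\<^sub>R F'' q h b + (a' h \<bullet> b) *\<^sub>R F' q b)) (at q)"
    by (intro has_derivative_sum has_derivative_scaleR has_derivative_inner_left a dF')
  then show ?thesis
    by (simp add: F'_basis[symmetric] F''_basis[symmetric] sum.distrib)
qed

lemma has_derivative_horiz: "((\<lambda>q. horiz q v) has_derivative (\<lambda>h. (0, sform (fst h) v / 2))) (at q)"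
proof -
  have "((\<lambda>q. sform (fst q) v / 2) has_derivative (\<lambda>h. sform (fst h) v / 2)) (at q)"
    using bounded_linear_imp_has_derivative[OF bounded_linear_compose[OF sform.bounded_linear_left[of v] bounded_linear_fst]]
    by (auto intro!: derivative_eq_intros)
  from has_derivative_Pair[OF has_derivative_const this] show ?thesis
    unfolding horiz_def .
qed

lemma has_derivative_F'_horiz:
  "((\<lambda>q. F' q (horiz q v)) has_derivative
     (\<lambda>h. F'' q h (horiz q v) + F' q (0, sform (fst h) v / 2))) (at q)"
  by (rule has_derivative_F'_apply[OF has_derivative_horiz])

lemma has_derivative_A:
  "((\<lambda>q. A q v) has_derivative
     (\<lambda>h. fst (F'' q h (horiz q v) + F' q (0, sform (fst h) v / 2)))) (at q)"
  unfolding A_def by (rule has_derivative_fst[OF has_derivative_F'_horiz])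

lemma linear_A: "linear (A q)"
  unfolding A_def using linear_compose[OF linear_compose[OF linear_horiz linear_F'[of q]] linear_fst]
  by (simp add: o_def)

lemma inj_A: "inj (A q)"
  using immersive by (auto simp: linear_injective_0[OF linear_A] A_def)

lemma linear_\<Lambda>: "linear (\<Lambda> q)"
proof -
  have "linear (\<lambda>s. (0, s) :: 'n cheis)" by (rule linearI) auto
  from linear_compose[OF linear_compose[OF this linear_F'] linear_contact_form] show ?thesis
    by (simp add: \<Lambda>_def[abs_def] o_def)
qed

text \<open>Antisymmetrise the derivative of the contact equation; the second derivatives cancel.\<close>

lemma sform_A: "sform (A q u) (A q v) = \<Lambda> q (sform u v)"
proof -
  define X where "X u v = F'' q (horiz q u) (horiz q v) + F' q (0, sform u v / 2)" for u v
  have X: "contact_form (F q) (X u v) = sform (A q u) (A q v) / 2" for u v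
  proof -
    have 1: "((\<lambda>q. snd (F' q (horiz q v)) - sform (fst (F q)) (A q v) / 2) has_derivative
       (\<lambda>h. snd (F'' q h (horiz q v) + F' q (0, sform (fst h) v / 2))
          - (sform (fst (F q)) (fst (F'' q h (horiz q v) + F' q (0, sform (fst h) v / 2)))
             + sform (fst (F' q h)) (A q v)) / 2)) (at q)"
      by (intro has_derivative_diff has_derivative_snd has_derivative_F'_horiz
          bounded_linear.has_derivative[OF bounded_linear_divide] sform.FDERIV has_derivative_fst dF has_derivative_A)
    have 2: "(\<lambda>q. snd (F' q (horiz q v)) - sform (fst (F q)) (A q v) / 2) = (\<lambda>q. 0)"
      using contact[unfolded contact_form_def] unfolding A_def by (rule ext)
    from fun_cong[OF has_derivative_unique[OF 1[unfolded 2] has_derivative_const], of "horiz q u"]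
    have "snd (X u v) - (sform (fst (F q)) (fst (X u v)) + sform (A q u) (A q v)) / 2 = 0"
      unfolding X_def A_def fst_horiz .
    then show ?thesis
      by (simp add: contact_form_def add_divide_distrib)
  qed
  have "X u v - X v u = F' q (0, sform u v / 2) - F' q (0, - (sform u v / 2))"
    unfolding X_def F''_sym[of q "horiz q u"] sform_commute[of v u] by simp
  also have "\<dots> = F' q (0, sform u v)"
    unfolding linear_diff[OF linear_F', symmetric] by simp
  finally have "\<Lambda> q (sform u v) = contact_form (F q) (X u v) - contact_form (F q) (X v u)"
    by (simp add: \<Lambda>_def linear_diff[OF linear_contact_form, symmetric])
  also have "\<dots> = sform (A q u) (A q v)"
    unfolding X sform_commute[of "A q v"] by simp
  finally show ?thesis ..
qed

lemma continuous_A: "continuous_on UNIV (\<lambda>q. A q v)"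
  using has_derivative_A by (meson continuous_at_imp_continuous_on has_derivative_continuous)

lemma complex_linear_or_conjugate_linear:
  "(\<forall>q u. A q (\<i> *s u) = \<i> *s A q u) \<or> (\<forall>q u. A q (\<i> *s u) = (- \<i>) *s A q u)"
proof -
  define S where "S c = {q. \<forall>u. A q (\<i> *s u) = c *s A q u}" for c
  have "closed (S c)" for c
  proof -
    have "continuous_on UNIV (\<lambda>q. c *s A q u)" for u
    proof -
      have "linear (\<lambda>x. c *s x :: (complex, 'n + 'n) vec)"
        by (rule linearI) (auto simp: vec_eq_iff ring_distribs)
      then show ?thesis
        by (intro linear_continuous_on_compose[OF continuous_A])
    qed
    then show ?thesis
      unfolding S_def by (intro closed_Collect_all closed_Collect_eq continuous_A)
  qed
  moreover have "UNIV \<subseteq> S \<i> \<union> S (- \<i>)"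
    using symplectic_similitude_cases[OF linear_A inj_A linear_\<Lambda> sform_A] by (auto simp: S_def)
  moreover have "S \<i> \<inter> S (- \<i>) \<inter> UNIV = {}"
  proof -
    have False if "q \<in> S \<i>" "q \<in> S (- \<i>)" for q
    proof -
      define e :: "(complex, 'n + 'n) vec" where "e = axis undefined 1"
      have "\<i> *s A q e = (- \<i>) *s A q e"
        using that by (simp add: S_def)
      then have "A q e = 0" by (simp add: vec_eq_iff)
      then have "e = 0" using immersive[of q e] by (simp add: A_def)
      then show False by (simp add: e_def)
    qed
    then show ?thesis by blast
  qed
  ultimately have "S \<i> \<inter> UNIV = {} \<or> S (- \<i>) \<inter> UNIV = {}"
    using connected_UNIV[where 'a = "'n cheis"] unfolding connected_closed by blast
  with \<open>UNIV \<subseteq> _\<close> have "S \<i> = UNIV \<or> S (- \<i>) = UNIV" by blast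
  then show ?thesis by (auto simp: S_def)
qed

end

section \<open>Rigidity in the holomorphic case\<close>

lemma heis_line_ends: "p + heis_scale 0 a = p" "p + heis_scale 1 (q - p) = q"
  by (simp_all add: heis_scale_def prod_eq_iff)

lemma sform_bound: obtains B where "B > 0" "\<And>u v. norm (sform u v) \<le> B * norm u * norm v"
  using sform.pos_bounded by (metis mult.commute mult.left_commute)

locale holomorphic_contact_C2 = contact_C2 F F' F''
  for F :: "'n::finite cheis \<Rightarrow> 'n cheis" and F' F'' +
  fixes C :: real
  assumes A_i: "\<And>q u. A q (\<i> *s u) = \<i> *s A q u"
    and distortion: "\<And>q u v. norm (A q u) * norm v \<le> C * norm (A q v) * norm u"
begin

section \<open>The multiplier and the norm of the horizontal derivative\<close>

lemma A_scale: "A q (c *s u) = c *s A q u"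
  by (rule complex_linear_vecI[OF linear_A A_i vec_scale_eq_scaleR])

lemma surj_A: "surj (A q)"
  using linear_injective_imp_surjective[OF linear_A inj_A] by simp

lemma A_eq_0_iff: "A q u = 0 \<longleftrightarrow> u = 0"
  using immersive[of q u] linear_0[OF linear_A, of q] unfolding A_def by blast

definition \<mu> where "\<mu> q = \<Lambda> q 1"

text \<open>Every number has the form \<open>sform e (s *s f)\<close>, so \<open>\<Lambda>\<close>
  inherits complex linearity from \<open>A\<close> through \<open>sform_A\<close>.\<close>

lemma \<Lambda>_eq: "\<Lambda> q s = \<mu> q * s"
proof -
  define e :: "(complex, 'n + 'n) vec" where "e = axis (Inl undefined) 1"
  define f :: "(complex, 'n + 'n) vec" where "f = axis (Inr undefined) 1"
  have ef: "sform e (s *s f) = s" for s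
    unfolding sform_scale_right unfolding e_def f_def by simp
  have "\<Lambda> q s = \<Lambda> q (sform e (s *s f))" by (simp only: ef)
  also have "\<dots> = s * \<Lambda> q (sform e (1 *s f))"
    unfolding sform_A[symmetric] A_scale by simp
  finally show ?thesis by (simp only: ef \<mu>_def mult.commute)
qed

lemma sform_A_eq: "sform (A q u) (A q v) = \<mu> q * sform u v"
  by (simp only: sform_A \<Lambda>_eq)

text \<open>Let w = \<open>A q v\<close> be dual to \<open>A q u\<close>. Since w is as long as
  \<open>A q u\<close>, distortion bounds \<open>v\<close> by a multiple of \<open>u\<close>, and
  the square of the norm of \<open>A q u\<close> is the modulus of
  \<open>\<mu> q * sform u v\<close>. This turns bounded distortion into boundedness of quotients by
  \<open>\<mu>\<close>.\<close>

lemma norm_A_bound: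
  obtains K where "K > 0" "\<And>q u. (norm (A q u))\<^sup>2 \<le> K * norm (\<mu> q) * (norm u)\<^sup>2"
proof -
  obtain B where B: "B > 0" "\<And>u v :: (complex, 'n + 'n) vec. norm (sform u v) \<le> B * norm u * norm v"
    using sform_bound by blast
  have "(norm (A q u))\<^sup>2 \<le> B * (\<bar>C\<bar> + 1) * norm (\<mu> q) * (norm u)\<^sup>2" for q u
  proof (cases "u = 0")
    case True
    then show ?thesis using A_eq_0_iff by simp
  next
    case False
    define a where "a = A q u"
    have "norm a > 0" using False by (simp add: a_def A_eq_0_iff)
    obtain w where w: "norm w = norm a" "sform a w = of_real ((norm a)\<^sup>2)"
      by (rule sform_dual)
    obtain v where v: "A q v = w"
      using surj_A by (metis surjD)
    have "norm a * norm v \<le> norm a * (C * norm u)"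
      using distortion[of q u v] w by (simp add: a_def v mult_ac)
    then have "norm v \<le> C * norm u"
      using \<open>norm a > 0\<close> by simp
    also have "\<dots> \<le> (\<bar>C\<bar> + 1) * norm u"
      by (intro mult_right_mono) auto
    finally have nv: "norm v \<le> (\<bar>C\<bar> + 1) * norm u" .
    have "(norm a)\<^sup>2 = norm (sform a w)"
      by (simp only: w norm_of_real abs_power2)
    also have "\<dots> = norm (\<mu> q) * norm (sform u v)"
      by (simp add: a_def v[symmetric] sform_A_eq norm_mult)
    also have "\<dots> \<le> norm (\<mu> q) * (B * norm u * ((\<bar>C\<bar> + 1) * norm u))"
      using B(1) nv by (intro mult_left_mono order_trans[OF B(2)]) auto
    finally show ?thesis by (simp add: a_def power2_eq_square mult_ac)
  qed
  with B(1) show ?thesis by (intro that[of "B * (\<bar>C\<bar> + 1)"]) auto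
qed

text \<open>The derivative of \<open>\<lambda>q. A q v\<close> in direction \<open>h\<close>; the
  second summand arises because \<open>horiz q v\<close> moves with \<open>q\<close>.\<close>

definition D where "D q h v = fst (F'' q h (horiz q v) + F' q (0, sform (fst h) v / 2))"

lemma has_derivative_A': "((\<lambda>q. A q v) has_derivative (\<lambda>h. D q h v)) (at q)"
  unfolding D_def by (rule has_derivative_A)

lemma D_scale_right: "D q h (c *s v) = c *s D q h v"
proof -
  have "linear ((*s) c :: (complex, 'n + 'n) vec \<Rightarrow> _)"
    by (rule linearI) (auto simp: vec_eq_iff ring_distribs)
  then have "bounded_linear ((*s) c :: (complex, 'n + 'n) vec \<Rightarrow> _)"
    by (simp add: linear_conv_bounded_linear)
  from bounded_linear.has_derivative[OF this has_derivative_A'[of v q]]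
  have "((\<lambda>q. A q (c *s v)) has_derivative (\<lambda>h. c *s D q h v)) (at q)"
    by (simp add: A_scale)
  from has_derivative_unique[OF has_derivative_A' this] show ?thesis
    by (rule fun_cong)
qed

text \<open>The relation [X_u, X_v] = sform(u, v) Z applied to the first layer of \<open>F\<close>:
  \<open>A q v\<close> is its X_v-derivative, and the symmetric second derivatives cancel.\<close>

lemma D_commutator: "D q (horiz q u) v - D q (horiz q v) u = fst (F' q (0, sform u v))"
proof -
  have "D q (horiz q u) v - D q (horiz q v) u = fst (F' q (0, sform u v / 2) - F' q (0, - (sform u v / 2)))"
    unfolding D_def F''_sym[of q "horiz q u"] fst_horiz sform_commute[of v u] by simp
  then show ?thesis
    unfolding linear_diff[OF linear_F', symmetric] by simp
qed

text \<open>Horizontally this is \<open>A_i\<close>. For the vertical direction, \<open>D\<close> is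
  complex linear in its second slot but not yet known to be so in the first; the commutators of
  \<open>e\<close>, \<open>i e\<close> with \<open>v\<close>, \<open>i v\<close> give linear
  equations in \<open>P\<close>, \<open>Q\<close>, \<open>R\<close>, \<open>S\<close>, and
  elimination yields \<open>R = i P\<close>.\<close>

lemma fst_F'_i: "fst (F' q (heis_scale \<i> a)) = \<i> *s fst (F' q a)"
proof -
  define e :: "(complex, 'n + 'n) vec" where "e = axis (Inl undefined) 1"
  define f :: "(complex, 'n + 'n) vec" where "f = axis (Inr undefined) 1"
  have vertical: "fst (F' q (0, \<i> * s)) = \<i> *s fst (F' q (0, s))" for s
  proof -
    define v where "v = s *s f"
    have s: "sform e v = s"
      unfolding v_def sform_scale_right unfolding e_def f_def by simp
    define P where "P = D q (horiz q e) v"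
    define Q where "Q = D q (horiz q v) e"
    define R where "R = D q (horiz q (\<i> *s e)) v"
    define S where "S = D q (horiz q (\<i> *s v)) e"
    have PQ: "fst (F' q (0, s)) = P - Q"
      using D_commutator[of q e v] by (simp add: s P_def Q_def)
    have 1: "fst (F' q (0, \<i> * s)) = R - \<i> *s Q"
      using D_commutator[of q "\<i> *s e" v] by (simp add: s R_def Q_def D_scale_right)
    have 2: "fst (F' q (0, \<i> * s)) = \<i> *s P - S"
      using D_commutator[of q e "\<i> *s v"] by (simp add: s P_def S_def D_scale_right)
    have "fst (F' q (0, - s)) = \<i> *s R - \<i> *s S"
      using D_commutator[of q "\<i> *s e" "\<i> *s v"] by (simp add: s R_def S_def D_scale_right)
    moreover have "fst (F' q (0, - s)) = - fst (F' q (0, s))"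
      using linear_neg[OF linear_F', of q "(0, s)"] by simp
    ultimately have 3: "\<i> *s R - \<i> *s S = Q - P"
      by (simp add: PQ)
    have "R = \<i> *s P"
    proof -
      have "R $ j = \<i> * P $ j" for j
      proof -
        from 1 2 have "R $ j - \<i> * Q $ j = \<i> * P $ j - S $ j"
          by (metis vector_minus_component vector_smult_component)
        moreover from 3 have "\<i> * R $ j - \<i> * S $ j = Q $ j - P $ j"
          by (metis vector_minus_component vector_smult_component)
        ultimately show ?thesis
          by (simp add: complex_eq_iff)
      qed
      then show ?thesis by (simp add: vec_eq_iff)
    qed
    then show ?thesis
      by (simp add: 1 PQ vec_eq_iff algebra_simps)
  qed
  have "fst (F' q a) = A q (fst a) + fst (F' q (0, contact_form q a))" for a
    by (subst (1) horiz_decomp[of a q]) (simp add: linear_add[OF linear_F'] A_def)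
  note split = this
  have "contact_form q (heis_scale \<i> a) = \<i> * contact_form q a"
    by (simp add: contact_form_def heis_scale_simps algebra_simps)
  then show ?thesis
    unfolding split[of "heis_scale \<i> a"] split[of a]
    by (simp add: heis_scale_simps A_i vertical vec_eq_iff ring_distribs)
qed

lemma fst_F'_scale: "fst (F' q (heis_scale c a)) = c *s fst (F' q a)"
proof (rule complex_linear_vecI[where A = "\<lambda>a. fst (F' q a)", OF _ fst_F'_i heis_scale_eq_scaleR])
  show "linear (\<lambda>a. fst (F' q a))"
    using linear_compose[OF linear_F' linear_fst] by (simp add: o_def)
qed

text \<open>Differentiating \<open>fst_F'_scale\<close> gives complex linearity in the last slot;
  symmetry of \<open>F''\<close> moves it to the direction of differentiation, which makes
  \<open>A\<close> complex differentiable.\<close>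

lemma fst_F''_scale: "fst (F'' q (heis_scale c a) b) = c *s fst (F'' q a b)"
proof -
  have "linear ((*s) c :: (complex, 'n + 'n) vec \<Rightarrow> _)"
    by (rule linearI) (auto simp: vec_eq_iff ring_distribs)
  then have "bounded_linear ((*s) c :: (complex, 'n + 'n) vec \<Rightarrow> _)"
    by (simp add: linear_conv_bounded_linear)
  from bounded_linear.has_derivative[OF this has_derivative_fst[OF dF'[of a q]]]
  have "((\<lambda>q. fst (F' q (heis_scale c a))) has_derivative (\<lambda>h. c *s fst (F'' q h a))) (at q)"
    by (simp add: fst_F'_scale)
  from has_derivative_unique[OF has_derivative_fst[OF dF'] this]
  have "fst (F'' q b (heis_scale c a)) = c *s fst (F'' q b a)"
    by (rule fun_cong)
  then show ?thesis by (simp add: F''_sym[of q _ b])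
qed

lemma D_scale_left: "D q (heis_scale c h) v = c *s D q h v"
proof -
  have "fst (F' q (0, sform (c *s fst h) v / 2)) = c *s fst (F' q (0, sform (fst h) v / 2))"
    using fst_F'_scale[of q c "(0, sform (fst h) v / 2)"] by (simp add: heis_scale_def)
  then show ?thesis
    by (simp add: D_def fst_F''_scale heis_scale_simps vec_eq_iff ring_distribs)
qed

section \<open>Holomorphy along complex lines and the Liouville argument\<close>

lemma has_derivative_A_nth: "((\<lambda>q. A q v $ j) has_derivative (\<lambda>h. D q h v $ j)) (at q)"
  using bounded_linear.has_derivative[OF bounded_linear_vec_nth has_derivative_A'] .

lemma A_nth_line:
  "((\<lambda>\<tau>. A (p + heis_scale \<tau> a) v $ j) has_field_derivative D (p + heis_scale \<tau> a) a v $ j) (at \<tau>)"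
  by (rule has_field_derivative_heis_line[OF has_derivative_A_nth]) (simp add: D_scale_left)

lemma \<mu>_eq: "\<mu> q = sform (A q (axis (Inl undefined) 1)) (A q (axis (Inr undefined) 1))"
  by (simp add: sform_A_eq)

lemma \<mu>_nonzero: "\<mu> q \<noteq> 0"
proof -
  obtain K where K: "K > 0" "\<And>q u. (norm (A q u))\<^sup>2 \<le> K * norm (\<mu> q) * (norm u)\<^sup>2"
    using norm_A_bound by blast
  have "norm (A q (axis undefined 1)) > 0"
    by (simp add: A_eq_0_iff)
  with K(2)[of q "axis undefined 1"] show ?thesis by force
qed

lemma holomorphic_A_line: "(\<lambda>\<tau>. A (p + heis_scale \<tau> a) v $ j) holomorphic_on UNIV"
  unfolding holomorphic_on_def field_differentiable_def
  using has_field_derivative_at_within[OF A_nth_line] by blast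

lemma holomorphic_\<mu>_line: "(\<lambda>\<tau>. \<mu> (p + heis_scale \<tau> a)) holomorphic_on UNIV"
  unfolding \<mu>_eq sform_def by (intro holomorphic_intros holomorphic_A_line)

text \<open>On every complex line the quotient is a bounded entire function.\<close>

lemma A_quotient_constant: "A q v $ i * A q w $ j / \<mu> q = A p v $ i * A p w $ j / \<mu> p"
proof -
  obtain K where K: "K > 0" "\<And>q u. (norm (A q u))\<^sup>2 \<le> K * norm (\<mu> q) * (norm u)\<^sup>2"
    using norm_A_bound by blast
  define \<phi> where "\<phi> q = A q v $ i * A q w $ j / \<mu> q" for q
  have "norm (\<phi> q) \<le> K * norm v * norm w" for q
  proof -
    have bd: "norm (A q u) \<le> sqrt (K * norm (\<mu> q)) * norm u" for u
    proof -
      have "norm (A q u) \<le> sqrt (K * norm (\<mu> q) * (norm u)\<^sup>2)"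
        using K(2)[of q u] by (rule real_le_rsqrt)
      then show ?thesis by (simp add: real_sqrt_mult)
    qed
    have "norm (A q v $ i * A q w $ j) \<le> norm (A q v) * norm (A q w)"
      unfolding norm_mult by (intro mult_mono Finite_Cartesian_Product.norm_nth_le) auto
    also have "\<dots> \<le> (sqrt (K * norm (\<mu> q)) * norm v) * (sqrt (K * norm (\<mu> q)) * norm w)"
      using K(1) by (intro mult_mono bd) auto
    also have "\<dots> = (sqrt (K * norm (\<mu> q)))\<^sup>2 * norm v * norm w"
      by (simp add: power2_eq_square mult_ac)
    also have "\<dots> = K * norm v * norm w * norm (\<mu> q)"
      using K(1) by (simp add: mult_ac)
    finally show ?thesis
      using \<mu>_nonzero[of q] by (simp add: \<phi>_def norm_divide field_simps)
  qed
  then have "bounded (range (\<lambda>\<tau>. \<phi> (p + heis_scale \<tau> (q - p))))"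
    unfolding bounded_iff by blast
  moreover have "(\<lambda>\<tau>. \<phi> (p + heis_scale \<tau> (q - p))) holomorphic_on UNIV"
    unfolding \<phi>_def by (intro holomorphic_intros holomorphic_A_line holomorphic_\<mu>_line) (simp add: \<mu>_nonzero)
  ultimately have "(\<lambda>\<tau>. \<phi> (p + heis_scale \<tau> (q - p))) constant_on UNIV"
    by (intro Liouville_theorem)
  then have "\<phi> (p + heis_scale 1 (q - p)) = \<phi> (p + heis_scale 0 (q - p))"
    unfolding constant_on_def by (metis UNIV_I)
  then show ?thesis
    by (simp add: \<phi>_def heis_line_ends)
qed

text \<open>Dividing the constant quotient for the entries (u, j), (e, k) by the one for (e, k), (e,
  k) shows that the ratio of any entry to the entry (e, k) does not depend on \<open>q\<close>. The
  latter never vanishes, because its square over \<open>\<mu>\<close> is a nonzero constant.\<close>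

lemma conformal_factor:
  obtains h h' where "\<And>q. h q \<noteq> 0" "\<And>q u. A q u = h q *s A 0 u"
    "\<And>q. (h has_derivative h' q) (at q)" "\<And>q c a. h' q (heis_scale c a) = c * h' q a" "h 0 = 1"
proof -
  define e :: "(complex, 'n + 'n) vec" where "e = axis undefined 1"
  have "A 0 e \<noteq> 0" by (simp add: A_eq_0_iff e_def)
  then obtain k where k: "A 0 e $ k \<noteq> 0" by (auto simp: vec_eq_iff)
  define h where "h q = A q e $ k / A 0 e $ k" for q
  define h' where "h' q a = D q a e $ k / A 0 e $ k" for q a
  have ne: "A q e $ k \<noteq> 0" for q
    using A_quotient_constant[of q e k e k 0] k \<mu>_nonzero[of 0] by force
  show ?thesis
  proof
    show "h q \<noteq> 0" for q using ne k by (simp add: h_def)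
    show "A q u = h q *s A 0 u" for q u
    proof -
      have "A q u $ j = h q * A 0 u $ j" for j
      proof -
        have e1: "A q u $ j * A q e $ k * \<mu> 0 = A 0 u $ j * A 0 e $ k * \<mu> q"
          using A_quotient_constant[of q u j e k 0] \<mu>_nonzero by (simp add: frac_eq_eq)
        have e2: "A q e $ k * A q e $ k * \<mu> 0 = A 0 e $ k * A 0 e $ k * \<mu> q"
          using A_quotient_constant[of q e k e k 0] \<mu>_nonzero by (simp add: frac_eq_eq)
        have "(A q u $ j * A 0 e $ k) * (A q e $ k * \<mu> 0) = A 0 e $ k * (A q u $ j * A q e $ k * \<mu> 0)"
          by (simp only: mult_ac)
        also have "\<dots> = A 0 u $ j * (A q e $ k * A q e $ k * \<mu> 0)"
          unfolding e1 e2 by (simp only: mult_ac)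
        finally have "(A q u $ j * A 0 e $ k) * (A q e $ k * \<mu> 0) = (A q e $ k * A 0 u $ j) * (A q e $ k * \<mu> 0)"
          by (simp only: mult_ac)
        then have "A q u $ j * A 0 e $ k = A q e $ k * A 0 u $ j"
          using ne[of q] \<mu>_nonzero[of 0] by simp
        then show ?thesis using k by (simp add: h_def field_simps)
      qed
      then show ?thesis by (simp add: vec_eq_iff)
    qed
    show "(h has_derivative h' q) (at q)" for q
      unfolding h_def[abs_def] h'_def[abs_def]
      by (intro bounded_linear.has_derivative[OF bounded_linear_divide] has_derivative_A_nth)
    show "h' q (heis_scale c a) = c * h' q a" for q c a
      by (simp add: h'_def D_scale_left)
    show "h 0 = 1" using k by (simp add: h_def)
  qed
qed

text \<open>The vertical derivative of the first layer enters the commutators of h, so both claims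
  are proved together. In the proof \<open>\<zeta>\<close> is this derivative pulled back by
  \<open>A 0\<close>, and \<open>k q u\<close> is the derivative of h along the horizontal field of
  \<open>u\<close>.\<close>

lemma A_constant_and_vertical:
  "A q u = A 0 u" "fst (F' q (0, s)) = 0"
proof -
  obtain h h' where h_nz: "\<And>q. h q \<noteq> 0" and A_h: "\<And>q u. A q u = h q *s A 0 u"
    and h': "\<And>q. (h has_derivative h' q) (at q)"
    and h'_scale: "\<And>q c a. h' q (heis_scale c a) = c * h' q a" and h0: "h 0 = 1"
    using conformal_factor by blast
  obtain B where B: "linear B" and BA: "B (A 0 x) = x" for x
    using linear_injective_left_inverse[OF linear_A inj_A] by (metis comp_apply id_apply)
  have AB: "A 0 (B x) = x" for x
    using surj_A by (metis BA surjD)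
  have B_scale: "B (c *s x) = c *s B x" for c x
    by (metis AB BA A_scale)
  have bl_scale: "bounded_linear (\<lambda>c. c *s v)" for v :: "(complex, 'n + 'n) vec"
  proof -
    have "linear (\<lambda>c. c *s v)" by (rule linearI) (auto simp: vec_eq_iff ring_distribs)
    then show ?thesis by (simp add: linear_conv_bounded_linear)
  qed
  have D_h: "D q a u = h' q a *s A 0 u" for q a u
  proof -
    have "((\<lambda>q. A q u) has_derivative (\<lambda>a. h' q a *s A 0 u)) (at q)"
      by (subst A_h) (rule bounded_linear.has_derivative[OF bl_scale h'])
    from has_derivative_unique[OF has_derivative_A' this] show ?thesis
      by (rule fun_cong)
  qed
  define \<zeta> where "\<zeta> q = B (fst (F' q (0, 1)))" for q
  define k where "k q u = h' q (horiz q u)" for q u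
  have vert: "fst (F' q (0, s)) = s *s A 0 (\<zeta> q)" for q s
    using fst_F'_scale[of q s "(0, 1)"] by (simp add: heis_scale_def \<zeta>_def AB)
  \<comment> \<open>\<open>D_commutator\<close> with \<open>A 0\<close> cancelled.\<close>
  have rel: "sform u v *s \<zeta> q = k q u *s v - k q v *s u" for q u v
    using arg_cong[OF D_commutator[of q u v], of B]
    by (simp add: D_h vert linear_diff[OF B] B_scale BA k_def)
  define i :: 'n where "i = undefined"
  have ax: "(axis (Inl i) 1 :: (complex, 'n + 'n) vec) $ Inr i = 0"
    by (simp add: axis_def)
  \<comment> \<open>In one coordinate plane the relation determines \<open>k\<close>: it is the
    symplectic pairing of \<open>u\<close> with \<open>\<zeta> q\<close> in that plane.\<close>
  have k_eq: "k q u = \<zeta> q $ Inr i * u $ Inl i - \<zeta> q $ Inl i * u $ Inr i" for q u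
  proof -
    have "\<zeta> q $ Inr i = k q (axis (Inl i) 1)"
      using arg_cong[OF rel[of "axis (Inl i) 1" "axis (Inr i) 1" q], of "\<lambda>x. x $ Inr i"]
      by (simp add: ax)
    moreover have "u $ Inr i * \<zeta> q $ Inl i = k q (axis (Inl i) 1) * u $ Inl i - k q u"
      using arg_cong[OF rel[of "axis (Inl i) 1" u q], of "\<lambda>x. x $ Inl i"] by simp
    ultimately show ?thesis by (simp add: algebra_simps)
  qed
  \<comment> \<open>The vertical field commutes with the horizontal ones, so this is the vertical
    derivative of \<open>A q u = h q *s A 0 u\<close>, pulled back by \<open>A 0\<close>.\<close>
  have \<zeta>_line: "((\<lambda>\<tau>. \<zeta> (p + heis_scale \<tau> (horiz p u)) $ j) has_field_derivative
      h' (p + heis_scale \<tau> (horiz p u)) (0, 1) * u $ j) (at \<tau>)" for p u j \<tau>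
  proof -
    define q where "q = p + heis_scale \<tau> (horiz p u)"
    have hor: "horiz p u = horiz q u" by (simp add: q_def)
    have bl: "bounded_linear (\<lambda>x. B x $ j)"
      using bounded_linear_compose[OF bounded_linear_vec_nth] B by (simp add: linear_conv_bounded_linear)
    have "((\<lambda>q. \<zeta> q $ j) has_derivative (\<lambda>x. B (fst (F'' q x (0, 1))) $ j)) (at q)"
      unfolding \<zeta>_def by (rule bounded_linear.has_derivative[OF bl has_derivative_fst[OF dF']])
    then have "((\<lambda>\<tau>. \<zeta> (p + heis_scale \<tau> (horiz p u)) $ j) has_field_derivative
        B (fst (F'' q (horiz p u) (0, 1))) $ j) (at \<tau>)"
      unfolding q_def by (rule has_field_derivative_heis_line) (simp add: fst_F''_scale B_scale)
    also have "fst (F'' q (horiz p u) (0, 1)) = D q (0, 1) u"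
      unfolding hor D_def F''_sym[of q "horiz q u"]
      by (simp add: sform.zero_left linear_0[OF linear_F', unfolded zero_prod_def] zero_prod_def)
    finally show ?thesis
      by (simp add: D_h B_scale BA q_def)
  qed
  have k0: "k p u = 0" for p u
  proof -
    define q where "q \<tau> = p + heis_scale \<tau> (horiz p u)" for \<tau>
    have hor: "horiz p u = horiz (q \<tau>) u" for \<tau> by (simp add: q_def)
    \<comment> \<open>By \<open>\<zeta>_line\<close> the derivative pairs \<open>u\<close> with
      itself.\<close>
    have "((\<lambda>\<tau>. k (q \<tau>) u) has_field_derivative 0) (at \<tau>)" for \<tau>
    proof -
      have "((\<lambda>\<tau>. \<zeta> (q \<tau>) $ Inr i * u $ Inl i - \<zeta> (q \<tau>) $ Inl i * u $ Inr i) has_field_derivative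
          h' (q \<tau>) (0, 1) * u $ Inr i * u $ Inl i - h' (q \<tau>) (0, 1) * u $ Inl i * u $ Inr i) (at \<tau>)"
        unfolding q_def by (intro DERIV_diff DERIV_cmult_right \<zeta>_line)
      then show ?thesis unfolding k_eq by (simp add: mult_ac)
    qed
    then obtain c where c: "\<And>\<tau>. k (q \<tau>) u = c"
      using has_field_derivative_zero_constant[of UNIV "\<lambda>\<tau>. k (q \<tau>) u"] by auto
    have "((\<lambda>\<tau>. h (q \<tau>)) has_field_derivative c) (at \<tau>)" for \<tau>
    proof -
      have "h' (q \<tau>) (horiz p u) = c"
        unfolding hor[of \<tau>] using c[of \<tau>] by (simp add: k_def)
      then show ?thesis
        using has_field_derivative_heis_line[OF h' h'_scale, where p = p and \<tau> = \<tau> and a = "horiz p u"] by (simp add: q_def)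
    qed
    then have "((\<lambda>\<tau>. h (q \<tau>) - c * \<tau>) has_field_derivative 0) (at \<tau>)" for \<tau>
      by (auto intro!: derivative_eq_intros)
    then obtain b where "\<And>\<tau>. h (q \<tau>) - c * \<tau> = b"
      using has_field_derivative_zero_constant[of UNIV "\<lambda>\<tau>. h (q \<tau>) - c * \<tau>"] by auto
    then have b: "h (q \<tau>) = b + c * \<tau>" for \<tau>
      by (metis diff_add_cancel)
    \<comment> \<open>A nonconstant affine function on the complex plane has a zero, but h has
      none.\<close>
    have "c = 0"
    proof (rule ccontr)
      assume "c \<noteq> 0"
      then have "h (q (- b / c)) = 0" by (simp add: b)
      then show False using h_nz by blast
    qed
    moreover have "q 0 = p" by (simp add: q_def heis_line_ends)
    ultimately show ?thesis using c[of 0] by simp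
  qed
  have \<zeta>0: "\<zeta> q = 0" for q
    using rel[of "axis (Inl i) 1" "axis (Inr i) 1" q] by (simp add: k0)
  show vert0: "fst (F' q (0, s)) = 0" for q s
    by (simp add: vert \<zeta>0 linear_0[OF linear_A])
  \<comment> \<open>The derivative of the vanishing \<open>\<zeta>\<close> is 0, and
    \<open>\<zeta>_line\<close> identifies it with the vertical derivative of h.\<close>
  have "h' q (0, 1) = 0" for q
  proof -
    define e :: "(complex, 'n + 'n) vec" where "e = axis (Inl i) 1"
    have "\<zeta> (q + heis_scale \<tau> (horiz q e)) $ Inl i = 0" for \<tau> by (simp add: \<zeta>0)
    then have "((\<lambda>\<tau>. 0) has_field_derivative h' (q + heis_scale 0 (horiz q e)) (0, 1) * e $ Inl i) (at 0)"
      using \<zeta>_line[of q e "Inl i" 0] by simp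
    from DERIV_unique[OF this DERIV_const] show ?thesis
      by (simp add: e_def heis_line_ends)
  qed
  then have "h' q (0, s) = 0" for q s
    using h'_scale[of q s "(0, 1)"] by (simp add: heis_scale_def)
  then have "h' q a = 0" for q a
    using linear_add[OF bounded_linear.linear[OF has_derivative_bounded_linear[OF h'[of q]]],
        of "horiz q (fst a)" "(0, contact_form q a)"] k0[of q "fst a"]
    by (simp add: k_def horiz_decomp[of a q, symmetric])
  then have "h' q = (\<lambda>_. 0)" for q by (rule ext)
  then obtain c where "\<And>q. h q = c"
    using has_derivative_zero_constant[of UNIV h] h' by (metis UNIV_I convex_UNIV)
  with h0 have "h q = 1" for q by metis
  then show "A q u = A 0 u"
    by (simp add: A_h[of q u])
qed

section \<open>Integration to an affine map\<close>

lemma fst_F'_eq: "fst (F' q a) = A 0 (fst a)"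
proof -
  have "fst (F' q a) = A q (fst a) + fst (F' q (0, contact_form q a))"
    by (subst (1) horiz_decomp[of a q]) (simp add: linear_add[OF linear_F'] A_def)
  then show ?thesis
    by (simp only: A_constant_and_vertical(1) [of q] A_constant_and_vertical(2) add_0_right)
qed

lemma fst_F: "fst (F q) = A 0 (fst q) + fst (F 0)"
proof -
  have bl: "bounded_linear (\<lambda>q :: 'n cheis. A 0 (fst q))"
    using bounded_linear_compose[OF linear_A[of 0, unfolded linear_conv_bounded_linear] bounded_linear_fst] .
  have "((\<lambda>q. fst (F q) - A 0 (fst q)) has_derivative (\<lambda>a. 0)) (at q)" for q
    using has_derivative_diff[OF has_derivative_fst[OF dF] bounded_linear_imp_has_derivative[OF bl]]
    by (simp add: fst_F'_eq)
  then obtain c where c: "\<And>q. fst (F q) - A 0 (fst q) = c"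
    using has_derivative_zero_constant[of UNIV "\<lambda>q. fst (F q) - A 0 (fst q)"] by (metis UNIV_I convex_UNIV)
  from c[of q] c[of 0] show ?thesis
    by (simp add: linear_0[OF linear_A] algebra_simps)
qed

lemma \<mu>_constant: "\<mu> q = \<mu> 0"
  by (simp only: \<mu>_eq A_constant_and_vertical(1)[of q])

text \<open>\<open>F\<close> pulls the contact form back to \<open>\<mu> 0\<close> times itself.
  After inserting \<open>fst_F\<close>, the terms with \<open>sform (fst q) (fst a)\<close> cancel
  by \<open>sform_A_eq\<close>, so the derivative no longer depends on \<open>q\<close>.\<close>

lemma snd_F'_eq: "snd (F' q a) = \<mu> 0 * snd a + sform (fst (F 0)) (A 0 (fst a)) / 2"
proof -
  have "contact_form (F q) (F' q a) = contact_form (F q) (F' q (horiz q (fst a))) + \<Lambda> q (contact_form q a)"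
    by (subst (1) horiz_decomp[of a q])
       (simp add: linear_add[OF linear_F'] linear_add[OF linear_contact_form] \<Lambda>_def)
  then have "contact_form (F q) (F' q a) = \<mu> 0 * contact_form q a"
    by (simp add: contact \<Lambda>_eq \<mu>_constant[of q])
  then have "snd (F' q a) = \<mu> 0 * contact_form q a + sform (fst (F q)) (A 0 (fst a)) / 2"
    by (simp add: contact_form_def[of "F q"] fst_F'_eq algebra_simps)
  then show ?thesis
    by (simp add: fst_F[of q] sform.add_left sform_A_eq contact_form_def right_diff_distrib add_divide_distrib)
qed

lemma F_affine:
  "F q = (A 0 (fst q), \<mu> 0 * snd q + sform (fst (F 0)) (A 0 (fst q)) / 2) + F 0"
proof -
  define L where "L q = (A 0 (fst q), \<mu> 0 * snd q + sform (fst (F 0)) (A 0 (fst q)) / 2)" for q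
  have L: "F' q = L" for q
    by (rule ext) (simp add: L_def prod_eq_iff fst_F'_eq snd_F'_eq)
  have "((\<lambda>q. F q - L q) has_derivative (\<lambda>a. 0)) (at q)" for q
    using has_derivative_diff[OF dF bounded_linear_imp_has_derivative[OF has_derivative_bounded_linear[OF dF]], of q q]
    by (simp add: L)
  then obtain c where c: "\<And>q. F q - L q = c"
    using has_derivative_zero_constant[of UNIV "\<lambda>q. F q - L q"] by (metis UNIV_I convex_UNIV)
  have "L 0 = 0" using linear_0[OF linear_F'] by (simp add: L)
  with c[of q] c[of 0] have "F q = L q + F 0"
    by (simp add: diff_eq_eq add.commute)
  then show ?thesis
    by (simp only: L_def)
qed

lemma affine_conclusion:
  assumes "bij F"
  shows "(\<exists>f. complex_affine (*s) f \<and> is_lifting F f) \<and> complex_affine heis_scale F"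
proof
  have vs1: "vector_space ((*s) :: complex \<Rightarrow> (complex, 'n + 'n) vec \<Rightarrow> _)"
    by (rule vec.vector_space_axioms)
  have vs2: "vector_space (heis_scale :: complex \<Rightarrow> 'n cheis \<Rightarrow> _)"
    by unfold_locales (auto simp: heis_scale_def prod_eq_iff vec_eq_iff ring_distribs)
  define f where "f p = A 0 p + fst (F 0)" for p
  have fst_F_f: "fst (F q) = f (fst q)" for q
    unfolding f_def by (rule fst_F)
  have "Vector_Spaces.linear (*s) (*s) (A 0)"
    unfolding Vector_Spaces.linear_iff using vs1 by (auto simp: linear_add[OF linear_A] A_scale)
  then have "complex_affine (*s) f"
    unfolding complex_affine_def f_def by blast
  moreover have "is_lifting F f"
    unfolding is_lifting_def
  proof (intro allI set_eqI iffI)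
    fix p x assume "x \<in> F ` (fst -` {p})"
    then show "x \<in> fst -` {f p}" by (auto simp: fst_F_f)
  next
    fix p and x :: "'n cheis" assume x: "x \<in> fst -` {f p}"
    \<comment> \<open>Surjectivity of \<open>F\<close> supplies the preimage; injectivity of
      \<open>A 0\<close> puts it in the fibre over \<open>p\<close>.\<close>
    obtain y where y: "x = F y" using assms by (metis bij_pointE)
    with x have "A 0 (fst y) = A 0 p" by (simp add: fst_F_f) (simp add: f_def)
    then have "fst y = p" using inj_A by (metis injD)
    with y show "x \<in> F ` (fst -` {p})" by blast
  qed
  ultimately show "\<exists>f. complex_affine (*s) f \<and> is_lifting F f" by blast
  define L where "L q = (A 0 (fst q), \<mu> 0 * snd q + sform (fst (F 0)) (A 0 (fst q)) / 2)" for q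
  have "Vector_Spaces.linear heis_scale heis_scale L"
    unfolding Vector_Spaces.linear_iff using vs2
    by (auto simp: L_def linear_add[OF linear_A] A_scale sform.add_right heis_scale_def ring_distribs add_divide_distrib)
  then show "complex_affine heis_scale F"
    unfolding complex_affine_def
    by (intro exI[of _ L] exI[of _ "F 0"] conjI allI) (auto simp: L_def intro: F_affine)
qed

end

section \<open>The conjugate case\<close>

lemma heis_conj_eq: "heis_conj p = (cnj_vec (fst p), cnj (snd p))"
  by (simp add: heis_conj_def cnj_vec_def)

lemma linear_heis_conj: "linear heis_conj"
  by (rule linearI) (auto simp: heis_conj_eq linear_add[OF linear_cnj_vec] linear_scale[OF linear_cnj_vec])

lemma bij_heis_conj: "bij heis_conj"
  by (rule involuntory_imp_bij) (simp add: heis_conj_eq)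

lemma heis_conj_horiz: "heis_conj (horiz q v) = horiz (heis_conj q) (cnj_vec v)"
  by (simp add: heis_conj_eq horiz_def sform_cnj_vec)

text \<open>Conjugation is real linear and, by \<open>heis_conj_horiz\<close>, maps horizontal
  fields to horizontal fields, so precomposition with it preserves every assumption of the
  locale.\<close>

lemma contact_C2_heis_conj:
  assumes "contact_C2 F F' F''"
  shows "contact_C2 (F \<circ> heis_conj) (\<lambda>q a. F' (heis_conj q) (heis_conj a))
    (\<lambda>q a b. F'' (heis_conj q) (heis_conj a) (heis_conj b))"
proof -
  interpret contact_C2 F F' F'' by fact
  have conj: "(heis_conj has_derivative heis_conj) (at q)" for q :: "'a cheis"
    using linear_heis_conj by (intro bounded_linear_imp_has_derivative) (simp add: linear_conv_bounded_linear)
  show ?thesis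
  proof
    show "((F \<circ> heis_conj) has_derivative (\<lambda>a. F' (heis_conj q) (heis_conj a))) (at q)" for q
      using has_derivative_compose[OF conj dF] by (simp add: o_def)
    show "((\<lambda>q. F' (heis_conj q) (heis_conj v)) has_derivative
        (\<lambda>h. F'' (heis_conj q) (heis_conj h) (heis_conj v))) (at q)" for q v
      by (rule has_derivative_compose[OF conj dF'])
    show "contact_form ((F \<circ> heis_conj) q) (F' (heis_conj q) (heis_conj (horiz q v))) = 0" for q v
      by (simp add: heis_conj_horiz contact)
    show "v = 0" if "fst (F' (heis_conj q) (heis_conj (horiz q v))) = 0" for q v
    proof -
      have "cnj_vec v = 0"
        using that unfolding heis_conj_horiz by (rule immersive)
      then show ?thesis by (metis norm_cnj_vec norm_eq_zero)
    qed
  qed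
qed

theorem proposition4p2:
  fixes F :: "'n::finite cheis \<Rightarrow> 'n cheis"
    and g :: "(complex, 'n + 'n) vec \<Rightarrow> (complex, 'n + 'n) vec \<Rightarrow> real"
  assumes "real_inner_product g"
    and "homeomorphism UNIV UNIV F (inv F)"
    and "quasiconformal (carnot_dist g) F"
    and "C2_diffeomorphism F"
  shows "\<exists>G\<in>{F, F \<circ> heis_conj}.
           (\<exists>f. complex_affine (*s) f \<and> is_lifting G f) \<and> complex_affine heis_scale G"
proof -
  obtain k K where "carnot_distance (carnot_dist g) k K"
    using carnot_dist_bounds[OF assms(1)] unfolding carnot_distance_def by metis
  then interpret carnot_distance "carnot_dist g" k K .
  obtain H where H: "0 < H" and qc: "\<And>x. eventually (\<lambda>r. \<forall>y y'. carnot_dist g x y \<le> r \<longrightarrow> r \<le> carnot_dist g x y' \<longrightarrow>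
      carnot_dist g (F x) (F y) \<le> H * carnot_dist g (F x) (F y')) (at_right 0)"
    using quasiconformal_eventually[OF assms(3) dist_nonneg] by blast
  have "bij F" using assms(4) by (simp add: C2_diffeomorphism_def)
  obtain Fb and Fbb :: "'n cheis \<Rightarrow> 'n cheis \<Rightarrow>\<^sub>L 'n cheis \<Rightarrow>\<^sub>L 'n cheis"
    where Fb: "\<And>x. (F has_derivative blinfun_apply (Fb x)) (at x)"
      and Fbb: "\<And>x. (Fb has_derivative blinfun_apply (Fbb x)) (at x)"
    using assms(4) unfolding C2_diffeomorphism_def C2_map_def by blast
  obtain Gb :: "'n cheis \<Rightarrow> 'n cheis \<Rightarrow>\<^sub>L 'n cheis" where Gb: "\<And>x. (inv F has_derivative blinfun_apply (Gb x)) (at x)"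
    using assms(4) unfolding C2_diffeomorphism_def C2_map_def by blast
  define F' where "F' q = blinfun_apply (Fb q)" for q
  define F'' where "F'' q h v = blinfun_apply (blinfun_apply (Fbb q) h) v" for q h v
  have dF: "(F has_derivative F' q) (at q)" for q
    unfolding F'_def by (rule Fb)
  have dF': "((\<lambda>q. F' q v) has_derivative (\<lambda>h. F'' q h v)) (at q)" for q v
    unfolding F'_def F''_def by (rule bounded_linear.has_derivative[OF blinfun.bounded_linear_left Fbb])
  have cont: "continuous_on UNIV (\<lambda>q. F' q a)" for a
    using dF' by (meson continuous_at_imp_continuous_on has_derivative_continuous)
  have contact: "contact_form (F q) (F' q (horiz q v)) = 0" for q v
    using quasiconformal_contact[OF dF qc H] .
  have "contact_C2 F F' F''"
  proof
    fix q v assume "fst (F' q (horiz q v)) = 0"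
    then have F0: "F' q (horiz q v) = 0"
      using contact[of q v] by (simp add: contact_form_eq_0 linear_0[OF linear_horiz])
    \<comment> \<open>If \<open>F' q\<close> kills a horizontal vector, the chain rule for the
      inverse forces that vector to be 0.\<close>
    have "((\<lambda>x. inv F (F x)) has_derivative (\<lambda>a. Gb (F q) (F' q a))) (at q)"
      by (rule has_derivative_compose[OF dF Gb])
    moreover have "(\<lambda>x. inv F (F x)) = (\<lambda>x. x)"
      using \<open>bij F\<close> by (simp add: bij_is_inj fun_eq_iff)
    ultimately have "(\<lambda>a. Gb (F q) (F' q a)) = (\<lambda>a. a)"
      using has_derivative_unique[OF _ has_derivative_ident] by metis
    from fun_cong[OF this, of "horiz q v"] have "horiz q v = 0"
      by (simp add: F0 blinfun.zero_right)
    then show "v = 0" by (metis fst_horiz fst_zero)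
  qed (fact dF dF' contact)+
  then interpret contact_C2 F F' F'' .
  define C where "C = H * K\<^sup>2 / k\<^sup>2"
  have dist: "norm (A q u) * norm v \<le> C * norm (A q v) * norm u" for q u v
    unfolding A_def C_def by (rule quasiconformal_distortion[OF dF cont contact qc H])
  from complex_linear_or_conjugate_linear show ?thesis
  proof
    assume "\<forall>q u. A q (\<i> *s u) = \<i> *s A q u"
    then interpret holomorphic_contact_C2 F F' F'' C
      by unfold_locales (use dist in auto)
    show ?thesis
      using affine_conclusion[OF \<open>bij F\<close>] by blast
  next
    assume conj: "\<forall>q u. A q (\<i> *s u) = (- \<i>) *s A q u"
    interpret conj: contact_C2 "F \<circ> heis_conj" "\<lambda>q a. F' (heis_conj q) (heis_conj a)"
      "\<lambda>q a b. F'' (heis_conj q) (heis_conj a) (heis_conj b)"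
      by (rule contact_C2_heis_conj) fact
    have A_conj: "conj.A q u = A (heis_conj q) (cnj_vec u)" for q u
      by (simp add: conj.A_def A_def heis_conj_horiz)
    interpret conj: holomorphic_contact_C2 "F \<circ> heis_conj" "\<lambda>q a. F' (heis_conj q) (heis_conj a)"
      "\<lambda>q a b. F'' (heis_conj q) (heis_conj a) (heis_conj b)" C
    proof
      show "conj.A q (\<i> *s u) = \<i> *s conj.A q u" for q u
      proof -
        have "cnj_vec (\<i> *s u) = (-1) *\<^sub>R (\<i> *s cnj_vec u)"
          by (simp add: vec_eq_iff)
        then show ?thesis
          unfolding A_conj by (simp only: linear_scale[OF linear_A] conj) (simp add: vec_eq_iff)
      qed
      \<comment> \<open>Conjugation is an isometry of the first layer, so the pointwise distortion
        bound of \<open>F\<close> carries over. This avoids comparing Carnot distances under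
        \<open>heis_conj\<close>, for which \<open>g\<close> might fail to be invariant.\<close>
      show "norm (conj.A q u) * norm v \<le> C * norm (conj.A q v) * norm u" for q u v
        unfolding A_conj using dist[of "heis_conj q" "cnj_vec u" "cnj_vec v"] by simp
    qed
    have "bij (F \<circ> heis_conj)"
      using bij_heis_conj \<open>bij F\<close> by (rule bij_comp)
    from conj.affine_conclusion[OF this] show ?thesis by blast
  qed
qed

end
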